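(* Let $N,M\ge1$ be integers, at least one of them even, and let $z=(z_1,\dots,z_{2N+2},z'_3,\dots,z'_{2M})$ be non-zero complex segment variables assigned to the diagram of the knot $J(N,-M)$ described in the context, such that two segments adjacent at a corner of a crossing have distinct variables. Then $z$ is a boundary parabolic solution if and only if there are complex numbers $p,q,r,\Lambda$ such that $$z_{2i-1}=\frac{pq\sqrt\Lambda\,B_{i-1}+p(r-q)B_i}{(r-q)B_{i-2}+p\sqrt\Lambda\,B_{i-1}},\qquad z_{2i}=\frac{pq\sqrt\Lambda\,B_{i-2}+p(r-q)B_{i-1}}{(r-q)B_{i-1}+p\sqrt\Lambda\,B_i}$$ for $1\le i\le N+1$, and $$z'_{2i-1}=\frac{(-1)^{\frac N2}F_NB'_{i-2}+pq\sqrt\Lambda\,B'_{i-1}}{p\sqrt\Lambda\,B'_{i-1}+(-1)^{\frac N2}G_{N+2}B'_i},\qquad z'_{2i}=\frac{(-1)^{\frac N2}F_NB'_{i-1}+pq\sqrt\Lambda\,B'_i}{p\sqrt\Lambda\,B'_{i-2}+(-1)^{\frac N2}G_{N+2}B'_{i-1}}$$ for $2\le i\le M$ (with non-zero denominators), where $(B_i)_{i\in\mathbb Z}$ is the base $\sqrt\Lambda$-Fibonacci sequence, $(B'_i)_{i\in\mathbb Z}$ is the base $\big((-1)^{\frac N2}\sqrt\Lambda\,B_N\big)$-Fibonacci sequence, $F_N=pq\sqrt\Lambda\,B_{N-1}+p(r-q)B_N$, $G_{N+2}=(r-q)B_N+p\sqrt\Lambda\,B_{N+1}$, and $\Lambda$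 satisfies $B'_{M+1}+(-1)^{\frac N2}B'_MB_{N-1}=0$.
   Context: **Fibonacci sequences.** For $W\in\mathbb C$, the base $W$-Fibonacci sequence $(B_i)_{i\in\mathbb Z}$ is defined by $B_0=0$, $B_1=1$, $B_{i+1}=WB_i+B_{i-1}$ for all $i\in\mathbb Z$. $\sqrt\Lambda$ is a fixed square root of $\Lambda$, and $(-1)^{N/2}$ means $\mathrm i^N$ for a fixed square root $\mathrm i$ of $-1$. **Diagram of $J(N,-M)$.** It consists of two twisted rows (boxes) of crossings. Box 1: a row of $N$ crossings numbered from left to right; the $i$-th crossing has upper-left segment $z_{2i-1}$, lower-left segment $z_{2i}$, upper-right segment $z_{2i+1}$, lower-right segment $z_{2i+2}$, and the strand joining upper-left to lower-right passes over. Box 2: a row of $M$ crossings numbered from left to right; the $i$-th crossing has upper-left segment $z'_{2i-1}$, lower-left segment $z'_{2i}$, upper-right segment $z'_{2i+1}$, lower-right segment $z'_{2i+2}$, and the strand joining upper-left to lower-right passes under. The boxes are placed in the plane (after rotating a box if necessary) and their ends are joined by disjoint arcs so that the following are the same segment: $z_{2N+2}=z'_1$, $z_2=z'_2$, $z_{2N+1}=z'_{2M+1}$, $z_1=z'_{2M+2}$. (Segments are denoted by their variables; there are $2(N+M)$ segments.) The diagram is given any orientation; the set of boundary parabolic solutions does not depend on it. **Boundary parabolic solution.** Left/right is with respect to the direction of travel along the oriented diagram, seen from above. For a segment with variable $z_c$ starting at a crossing $X$ and ending at a crossing $Y$, let $z_a,z_b$ be the variables of the two segments of the other strand at $X$ lying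 to its left and right, and $z_d,z_e$ those of the two segments of the other strand at $Y$ lying to its left and right. The hyperbolicity equation of the segment is: (a) over at $X$, under at $Y$: $\frac{z_c-z_a}{z_c-z_b}\cdot\frac{z_d(z_c-z_e)}{z_e(z_c-z_d)}=1$; (b) under at $X$, over at $Y$: $\frac{z_a(z_c-z_b)}{z_b(z_c-z_a)}\cdot\frac{z_c-z_d}{z_c-z_e}=1$; (c) over at both: $\frac{z_c-z_a}{z_c-z_b}\cdot\frac{z_c-z_e}{z_c-z_d}=1$; (d) under at both: $\frac{z_a(z_c-z_b)}{z_b(z_c-z_a)}\cdot\frac{z_e(z_c-z_d)}{z_d(z_c-z_e)}=1$. A boundary parabolic solution is a tuple of non-zero segment variables satisfying the hyperbolicity equation of every segment and such that two segments adjacent at a corner of a crossing (consecutive in the cyclic order around it) have distinct variables. *)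

theory Defs
  imports Complex_Main
begin

function fib_base :: "complex \<Rightarrow> int \<Rightarrow> complex" where
  "fib_base W i =
     (if i = 0 then 0
      else if i = 1 then 1
      else if i > 1 then W * fib_base W (i - 1) + fib_base W (i - 2)
      else fib_base W (i + 2) - W * fib_base W (i + 1))"
  by auto
termination
  by (relation "measure (\<lambda>(W, i). nat \<bar>2 * i - 1\<bar>)") auto

declare fib_base.simps [simp del]

lemma fib_base_0 [simp]: "fib_base W 0 = 0"
  by (subst fib_base.simps) simp

lemma fib_base_1 [simp]: "fib_base W 1 = 1"
  by (subst fib_base.simps) simp

lemma fib_base_rec: "fib_base W (i + 1) = W * fib_base W i + fib_base W (i - 1)"
proof (cases "i \<ge> 1")
  case True
  then show ?thesis
    by (subst fib_base.simps) (simp add: algebra_simps)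
next
  case False
  then have "fib_base W (i - 1) = fib_base W (i - 1 + 2) - W * fib_base W (i - 1 + 1)"
    by (subst fib_base.simps) simp
  then show ?thesis
    by (simp add: algebra_simps)
qed


text \<open>
  A diagram is given by its crossings, the segment incident to each of the four
  corners of a crossing, and the over/under information.  A crossing is viewed so that
  its two strands join \<open>UL\<close> to \<open>LR\<close> and \<open>LL\<close> to \<open>UR\<close>; rotating it in the plane
  preserves the counterclockwise order of the corners, which is all that is used below.
\<close>

datatype corner = UL | LL | LR | UR

fun ccw :: "corner \<Rightarrow> corner" where
  "ccw UL = LL"
| "ccw LL = LR"
| "ccw LR = UR"
| "ccw UR = UL"

fun cw :: "corner \<Rightarrow> corner" where
  "cw UL = UR"
| "cw UR = LR"
| "cw LR = LL"
| "cw LL = UL"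

definition opp :: "corner \<Rightarrow> corner" where
  "opp k = ccw (ccw k)"

record ('c, 's) diagram =
  crossings :: "'c set"
  seg :: "'c \<Rightarrow> corner \<Rightarrow> 's"
  ul_lr_over :: "'c \<Rightarrow> bool"

definition over_at :: "('c, 's) diagram \<Rightarrow> 'c \<Rightarrow> corner \<Rightarrow> bool" where
  "over_at D X k \<longleftrightarrow> (ul_lr_over D X \<longleftrightarrow> k \<in> {UL, LR})"

text \<open>
  An orientation is recorded as the set of those pairs (crossing, corner) through which
  the direction of travel leaves the crossing.  Each strand enters a crossing at one end and leaves
  at the opposite one; each segment leaves one of its ends and enters the other one.
\<close>

definition orientation :: "('c, 's) diagram \<Rightarrow> ('c \<times> corner) set \<Rightarrow> bool" where
  "orientation D out \<longleftrightarrow>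
     (\<forall>X\<in>crossings D. \<forall>k. (X, k) \<in> out \<longleftrightarrow> (X, opp k) \<notin> out) \<and>
     (\<forall>X\<in>crossings D. \<forall>Y\<in>crossings D. \<forall>k l.
        (X, k) \<noteq> (Y, l) \<and> seg D X k = seg D Y l \<longrightarrow> ((X, k) \<in> out \<longleftrightarrow> (Y, l) \<notin> out))"

text \<open>
  Equation of the segment leaving \<open>X\<close> at corner \<open>k\<close> and arriving at \<open>Y\<close> at corner \<open>l\<close>.
  A traveller leaving through \<open>k\<close> has \<open>ccw k\<close> on the left; a traveller arriving through \<open>l\<close> faces
  \<open>opp l\<close> and so has \<open>cw l\<close> on the left.
\<close>

definition hyperbolicity_eq ::
  "('c, 's) diagram \<Rightarrow> ('s \<Rightarrow> complex) \<Rightarrow> 'c \<Rightarrow> corner \<Rightarrow> 'c \<Rightarrow> corner \<Rightarrow> bool" where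
  "hyperbolicity_eq D w X k Y l \<longleftrightarrow>
     (let zc = w (seg D X k);
          za = w (seg D X (ccw k)); zb = w (seg D X (cw k));
          zd = w (seg D Y (cw l)); ze = w (seg D Y (ccw l))
      in if over_at D X k then
           (if over_at D Y l
            then (zc - za) / (zc - zb) * ((zc - ze) / (zc - zd)) = 1
            else (zc - za) / (zc - zb) * ((zd * (zc - ze)) / (ze * (zc - zd))) = 1)
         else
           (if over_at D Y l
            then (za * (zc - zb)) / (zb * (zc - za)) * ((zc - zd) / (zc - ze)) = 1
            else (za * (zc - zb)) / (zb * (zc - za)) * ((ze * (zc - zd)) / (zd * (zc - ze))) = 1))"

definition nonzero_variables :: "('c, 's) diagram \<Rightarrow> ('s \<Rightarrow> complex) \<Rightarrow> bool" where
  "nonzero_variables D w \<longleftrightarrow> (\<forall>X\<in>crossings D. \<forall>k. w (seg D X k) \<noteq> 0)"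

definition corners_distinct :: "('c, 's) diagram \<Rightarrow> ('s \<Rightarrow> complex) \<Rightarrow> bool" where
  "corners_distinct D w \<longleftrightarrow>
     (\<forall>X\<in>crossings D. \<forall>k. w (seg D X k) \<noteq> w (seg D X (ccw k)))"

definition boundary_parabolic ::
  "('c, 's) diagram \<Rightarrow> ('c \<times> corner) set \<Rightarrow> ('s \<Rightarrow> complex) \<Rightarrow> bool" where
  "boundary_parabolic D out w \<longleftrightarrow>
     nonzero_variables D w \<and> corners_distinct D w \<and>
     (\<forall>X\<in>crossings D. \<forall>Y\<in>crossings D. \<forall>k l.
        seg D X k = seg D Y l \<and> (X, k) \<in> out \<and> (Y, l) \<notin> out
        \<longrightarrow> hyperbolicity_eq D w X k Y l)"


datatype crossing = Box1 nat | Box2 nat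

datatype segment = Z nat | Z' nat

fun box_index :: "nat \<Rightarrow> corner \<Rightarrow> nat" where
  "box_index i UL = 2 * i - 1"
| "box_index i LL = 2 * i"
| "box_index i UR = 2 * i + 1"
| "box_index i LR = 2 * i + 2"

text \<open>
  The segment carrying \<open>z'\<^sub>j\<close>.  The four extreme segments of the second box are
  segments of the first box, so only \<open>Z' 3, \<dots>, Z' (2 * M)\<close> occur as separate segments.
\<close>

definition box2_seg :: "nat \<Rightarrow> nat \<Rightarrow> nat \<Rightarrow> segment" where
  "box2_seg N M j =
     (if j = 1 then Z (2 * N + 2)
      else if j = 2 then Z 2
      else if j = 2 * M + 1 then Z (2 * N + 1)
      else if j = 2 * M + 2 then Z 1
      else Z' j)"

definition J_diagram :: "nat \<Rightarrow> nat \<Rightarrow> (crossing, segment) diagram" where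
  "J_diagram N M =
     \<lparr> crossings = Box1 ` {1..N} \<union> Box2 ` {1..M},
       seg = (\<lambda>X k. case X of Box1 i \<Rightarrow> Z (box_index i k)
                             | Box2 i \<Rightarrow> box2_seg N M (box_index i k)),
       ul_lr_over = (\<lambda>X. case X of Box1 i \<Rightarrow> True | Box2 i \<Rightarrow> False) \<rparr>"

end

theory Submission
  imports Defs
begin

text \<open>
  The equation of a segment is a product of one factor per end, and it does not depend on the
  orientation.  Put \<open>a\<^sub>i = z\<^sub>2\<^sub>i\<^sub>-\<^sub>1\<close> and \<open>b\<^sub>i = z\<^sub>2\<^sub>i\<close>.  Inside a box the equations say that
  \<open>\<alpha>\<^sub>i = a\<^sub>i\<^sub>+\<^sub>1 - b\<^sub>i\<close> and \<open>\<beta>\<^sub>i = 1 / b\<^sub>i\<^sub>+\<^sub>1 - 1 / a\<^sub>i\<close> satisfy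
  \<open>\<alpha>\<^sub>i\<^sub>+\<^sub>1 = a\<^sub>i\<^sub>+\<^sub>1 b\<^sub>i\<^sub>+\<^sub>1 \<beta>\<^sub>i\<close> and \<open>\<alpha>\<^sub>i = a\<^sub>i\<^sub>+\<^sub>1 b\<^sub>i\<^sub>+\<^sub>1 \<beta>\<^sub>i\<^sub>+\<^sub>1\<close>.
  Hence \<open>\<Lambda> = \<alpha>\<^sub>i \<beta>\<^sub>i\<close> is constant, and the solutions are \<open>a\<^sub>i = F\<^sub>i / G\<^sub>i\<close>, \<open>b\<^sub>i = F\<^sub>i\<^sub>-\<^sub>1 / G\<^sub>i\<^sub>+\<^sub>1\<close>
  for base \<open>\<surd>\<Lambda>\<close> Fibonacci sequences \<open>F\<close> and \<open>G\<close>; the parity assumption excludes \<open>\<Lambda> = 0\<close>.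
  The equations of \<open>z\<^sub>2\<close> and \<open>z\<^sub>2\<^sub>N\<^sub>+\<^sub>2\<close> determine the first crossing of the second box, and with it
  the Fibonacci sequences \<open>F'\<close> and \<open>G'\<close> of that box.  That the second box ends in \<open>z\<^sub>1\<close> and
  \<open>z\<^sub>2\<^sub>N\<^sub>+\<^sub>1\<close> is then the single condition on \<open>\<Lambda>\<close>, and the two remaining equations hold
  automatically.
\<close>

section \<open>Fibonacci sequences\<close>

definition fib_rec :: "complex \<Rightarrow> (int \<Rightarrow> complex) \<Rightarrow> bool" where
  "fib_rec W X \<longleftrightarrow> (\<forall>i. X (i + 1) = W * X i + X (i - 1))"

lemma fib_recD: "fib_rec W X \<Longrightarrow> X (i + 1) = W * X i + X (i - 1)"
  by (simp add: fib_rec_def)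

lemma fib_rec_fib_base: "fib_rec W (fib_base W)"
  by (simp add: fib_rec_def fib_base_rec)

lemma fib_base_minus_1 [simp]: "fib_base W (-1) = 1"
  using fib_base_rec[of W 0] by simp

lemma fib_rec_combination:
  "fib_rec W (\<lambda>i. x * fib_base W (i + m) + y * fib_base W (i + n))"
  unfolding fib_rec_def
proof
  fix i
  have *: "fib_base W (i + 1 + k) = W * fib_base W (i + k) + fib_base W (i - 1 + k)" for k
    using fib_base_rec[of W "i + k"] by (simp add: algebra_simps)
  then show "x * fib_base W (i + 1 + m) + y * fib_base W (i + 1 + n) =
      W * (x * fib_base W (i + m) + y * fib_base W (i + n)) +
      (x * fib_base W (i - 1 + m) + y * fib_base W (i - 1 + n))"
    by (simp only: *) (simp add: algebra_simps)
qed

text \<open>Both sides satisfy the recurrence in \<open>n\<close>, so agreement at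
  \<open>n = 0\<close> and \<open>n = 1\<close> suffices; the former uses
  \<open>fib_base W (-1) = 1\<close>.\<close>

lemma fib_rec_add:
  assumes "fib_rec W X"
  shows "X (k + int n) = X (k + 1) * fib_base W (int n) + X k * fib_base W (int n - 1)"
proof (induction n rule: less_induct)
  case (less n)
  show ?case
  proof (cases "n \<le> 1")
    case True
    then have "n = 0 \<or> n = 1" by auto
    then show ?thesis by auto
  next
    case False
    define m where "m = n - 2"
    have n: "n = Suc (Suc m)" using False by (simp add: m_def)
    have "X (k + int n) = W * X (k + int (Suc m)) + X (k + int m)"
      using fib_recD[OF assms, of "k + int (Suc m)"] by (simp add: n algebra_simps)
    moreover have "fib_base W (int n) = W * fib_base W (int (Suc m)) + fib_base W (int m)"
      using fib_base_rec[of W "int (Suc m)"] by (simp add: n algebra_simps)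
    moreover have "fib_base W (int n - 1) = W * fib_base W (int (Suc m) - 1) + fib_base W (int m - 1)"
      using fib_base_rec[of W "int m"] by (simp add: n algebra_simps)
    ultimately show ?thesis
      using less[of "Suc m"] less[of m] by (simp add: n algebra_simps)
  qed
qed

lemma fib_rec_cross:
  assumes "fib_rec W X" "fib_rec W Y"
  shows "X k * Y (l + int n) - X (k + int n) * Y l =
    fib_base W (int n) * (X k * Y (l + 1) - X (k + 1) * Y l)"
  by (simp add: fib_rec_add[OF assms(1)] fib_rec_add[OF assms(2)] algebra_simps)

text \<open>The Casoratian changes sign at each step because the shift has determinant -1;
  \<open>X\<close> and \<open>Y\<close> may be read at different offsets.\<close>

lemma fib_rec_casoratian:
  assumes "fib_rec W X" "fib_rec W Y"
  shows "X (k + int n + 1) * Y (l + int n) - X (k + int n) * Y (l + int n + 1) =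
    (-1) ^ n * (X (k + 1) * Y l - X k * Y (l + 1))"
proof (induction n)
  case (Suc n)
  have "X (k + int (Suc n) + 1) = W * X (k + int n + 1) + X (k + int n)"
    "Y (l + int (Suc n) + 1) = W * Y (l + int n + 1) + Y (l + int n)"
    using fib_recD[OF assms(1), of "k + int n + 1"] fib_recD[OF assms(2), of "l + int n + 1"]
    by (simp_all add: algebra_simps)
  then show ?case using Suc by (simp add: algebra_simps)
qed simp

lemma fib_base_cassini:
  "fib_base W (int n + 1) * fib_base W (int n - 1) - (fib_base W (int n))\<^sup>2 = (-1) ^ n"
  using fib_rec_casoratian[OF fib_rec_fib_base fib_rec_fib_base, of W 0 n "-1"]
  by (simp add: algebra_simps power2_eq_square)

section \<open>Rows of twisted crossings\<close>

text \<open>The equations, cleared of denominators, of the segments \<open>a (i + 1)\<close> and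
  \<open>b (i + 1)\<close> between the crossings \<open>i\<close> and \<open>i + 1\<close>.\<close>

definition twist_eqs :: "nat \<Rightarrow> (nat \<Rightarrow> complex) \<Rightarrow> (nat \<Rightarrow> complex) \<Rightarrow> bool" where
  "twist_eqs n a b \<longleftrightarrow> (\<forall>i\<in>{1..<n}.
     a i * (a (i + 1) - a (i + 2)) = b (i + 1) * (a (i + 1) - a i) \<and>
     a (i + 1) * (b (i + 1) - b (i + 2)) = b (i + 2) * (b (i + 1) - b i))"

text \<open>A row of \<open>n\<close> crossings has \<open>n + 1\<close> pairs of segments. The
  index shifts give \<open>a (i + 1)\<close> and \<open>b i\<close> a common denominator, and
  \<open>a i\<close> and \<open>b (i + 1)\<close> a common numerator.\<close>

definition twist_form ::
  "nat \<Rightarrow> (int \<Rightarrow> complex) \<Rightarrow> (int \<Rightarrow> complex) \<Rightarrow> (nat \<Rightarrow> complex) \<Rightarrow> (nat \<Rightarrow> complex) \<Rightarrow> bool" where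
  "twist_form n F G a b \<longleftrightarrow> (\<forall>i\<in>{1..n + 1}. G (int i) \<noteq> 0 \<and> G (int i + 1) \<noteq> 0 \<and>
     a i = F (int i) / G (int i) \<and> b i = F (int i - 1) / G (int i + 1))"

text \<open>
  The gaps measure how far the two segments of the over strand, respectively of the under strand,
  at the \<open>i\<close>-th crossing are from being equal.  Their product does not depend on \<open>i\<close>; it is the
  constant \<open>\<Lambda>\<close> of the theorem.
\<close>

definition over_gap :: "(nat \<Rightarrow> complex) \<Rightarrow> (nat \<Rightarrow> complex) \<Rightarrow> nat \<Rightarrow> complex" where
  "over_gap a b i = 1 / b (i + 1) - 1 / a i"

definition under_gap :: "(nat \<Rightarrow> complex) \<Rightarrow> (nat \<Rightarrow> complex) \<Rightarrow> nat \<Rightarrow> complex" where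
  "under_gap a b i = a (i + 1) - b i"

text \<open>Dividing the two equations by \<open>a i\<close> and by \<open>b (i + 2)\<close>
  respectively leaves only gaps of neighbouring crossings: a gap is passed to the other strand at
  the next crossing.\<close>

lemma twist_eqs_gaps:
  assumes "\<And>i. 1 \<le> i \<Longrightarrow> i \<le> n + 1 \<Longrightarrow> a i \<noteq> 0 \<and> b i \<noteq> 0"
  shows "twist_eqs n a b \<longleftrightarrow> (\<forall>i\<in>{1..<n}.
     under_gap a b (i + 1) = a (i + 1) * b (i + 1) * over_gap a b i \<and>
     under_gap a b i = a (i + 1) * b (i + 1) * over_gap a b (i + 1))"
  unfolding twist_eqs_def
proof (intro ball_cong refl conj_cong)
  fix i assume i: "i \<in> {1..<n}"
  have nz: "a i \<noteq> 0" "a (i + 1) \<noteq> 0" "b (i + 1) \<noteq> 0" "b (i + 2) \<noteq> 0"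
    using assms[of i] assms[of "i + 1"] assms[of "i + 2"] i by auto
  have *: "a (i + 1) * b (i + 1) * over_gap a b i = (a (i + 1) * a i - a (i + 1) * b (i + 1)) / a i"
    using nz by (simp add: over_gap_def field_simps)
  have "under_gap a b (i + 1) = a (i + 1) * b (i + 1) * over_gap a b i \<longleftrightarrow>
    (a (i + 2) - b (i + 1)) * a i = a (i + 1) * a i - a (i + 1) * b (i + 1)"
    unfolding * under_gap_def using nz by (simp add: eq_divide_eq)
  also have "\<dots> \<longleftrightarrow> a i * (a (i + 1) - a (i + 2)) = b (i + 1) * (a (i + 1) - a i)"
    by (auto simp: algebra_simps)
  finally show "(a i * (a (i + 1) - a (i + 2)) = b (i + 1) * (a (i + 1) - a i)) =
    (under_gap a b (i + 1) = a (i + 1) * b (i + 1) * over_gap a b i)" by simp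
  have *: "a (i + 1) * b (i + 1) * over_gap a b (i + 1) =
    (a (i + 1) * b (i + 1) - b (i + 1) * b (i + 2)) / b (i + 2)"
    using nz by (simp add: over_gap_def field_simps)
  have "under_gap a b i = a (i + 1) * b (i + 1) * over_gap a b (i + 1) \<longleftrightarrow>
    (a (i + 1) - b i) * b (i + 2) = a (i + 1) * b (i + 1) - b (i + 1) * b (i + 2)"
    unfolding * under_gap_def using nz by (simp add: eq_divide_eq)
  also have "\<dots> \<longleftrightarrow> a (i + 1) * (b (i + 1) - b (i + 2)) = b (i + 2) * (b (i + 1) - b i)"
    by (auto simp: algebra_simps)
  finally show "(a (i + 1) * (b (i + 1) - b (i + 2)) = b (i + 2) * (b (i + 1) - b i)) =
    (under_gap a b i = a (i + 1) * b (i + 1) * over_gap a b (i + 1))" by simp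
qed

lemma twist_formD:
  assumes "twist_form n F G a b" "1 \<le> i" "i \<le> n + 1"
  shows "G (int i) \<noteq> 0" "G (int i + 1) \<noteq> 0" "a i = F (int i) / G (int i)"
    "b i = F (int i - 1) / G (int i + 1)"
  using assms unfolding twist_form_def by auto

lemma twist_formD_Suc:
  assumes "twist_form n F G a b" "i \<le> n"
  shows "G (int i + 1) \<noteq> 0" "G (int i + 2) \<noteq> 0" "a (i + 1) = F (int i + 1) / G (int i + 1)"
    "b (i + 1) = F (int i) / G (int i + 2)"
  using twist_formD[OF assms(1), of "i + 1"] assms(2) by (simp_all add: add.commute)

text \<open>Over the common denominator or numerator, a gap is one step of the recurrence. The
  product of the two gaps is therefore \<open>s * s\<close>.\<close>

lemma twist_form_gaps:
  assumes form: "twist_form n F G a b" and rec: "fib_rec s F" "fib_rec s G" and i: "1 \<le> i" "i \<le> n"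
    and nz: "a i \<noteq> 0"
  shows "under_gap a b i = s * F (int i) / G (int i + 1)"
    and "over_gap a b i = s * G (int i + 1) / F (int i)"
proof -
  have *: "G (int i) \<noteq> 0" "G (int i + 1) \<noteq> 0" "G (int i + 2) \<noteq> 0"
    "a i = F (int i) / G (int i)" "b i = F (int i - 1) / G (int i + 1)"
    "a (i + 1) = F (int i + 1) / G (int i + 1)" "b (i + 1) = F (int i) / G (int i + 2)"
    using twist_formD[OF form, of i] twist_formD_Suc[OF form, of i] i by auto
  have "under_gap a b i = (F (int i + 1) - F (int i - 1)) / G (int i + 1)"
    unfolding under_gap_def * by (simp add: diff_divide_distrib)
  then show "under_gap a b i = s * F (int i) / G (int i + 1)"
    using fib_recD[OF rec(1), of "int i"] by simp
  have "over_gap a b i = (G (int i + 2) - G (int i)) / F (int i)"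
    unfolding over_gap_def * by (simp add: diff_divide_distrib)
  then show "over_gap a b i = s * G (int i + 1) / F (int i)"
    using fib_recD[OF rec(2), of "int i + 1"] by (simp add: add.commute)
qed

lemma twist_eqs_of_form:
  assumes form: "twist_form n F G a b" and rec: "fib_rec s F" "fib_rec s G"
    and nz: "\<And>i. 1 \<le> i \<Longrightarrow> i \<le> n + 1 \<Longrightarrow> a i \<noteq> 0 \<and> b i \<noteq> 0"
  shows "twist_eqs n a b"
proof (subst twist_eqs_gaps, use nz in blast, rule ballI)
  fix i assume i: "i \<in> {1..<n}"
  have g: "under_gap a b i = s * F (int i) / G (int i + 1)"
    "over_gap a b i = s * G (int i + 1) / F (int i)"
    "under_gap a b (i + 1) = s * F (int i + 1) / G (int i + 2)"
    "over_gap a b (i + 1) = s * G (int i + 2) / F (int i + 1)"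
    using twist_form_gaps[OF form rec, of i] twist_form_gaps[OF form rec, of "i + 1"]
      nz[of i] nz[of "i + 1"] i by (auto simp: algebra_simps)
  have *: "G (int i + 1) \<noteq> 0" "G (int i + 2) \<noteq> 0"
    "a (i + 1) = F (int i + 1) / G (int i + 1)" "b (i + 1) = F (int i) / G (int i + 2)"
    using twist_formD_Suc[OF form, of i] i by auto
  then have "F (int i + 1) \<noteq> 0" "F (int i) \<noteq> 0" using nz[of "i + 1"] i by auto
  then show "under_gap a b (i + 1) = a (i + 1) * b (i + 1) * over_gap a b i \<and>
     under_gap a b i = a (i + 1) * b (i + 1) * over_gap a b (i + 1)"
    unfolding g using * by simp
qed

text \<open>The gap relations determine each pair of segments from the preceding ones, so the form
  spreads from the first crossing, whose two pairs are covered by \<open>base\<close>.\<close>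

lemma twist_form_of_eqs:
  assumes eqs: "twist_eqs n a b" and rec: "fib_rec s F" "fib_rec s G"
    and nz: "\<And>i. 1 \<le> i \<Longrightarrow> i \<le> n + 1 \<Longrightarrow> a i \<noteq> 0 \<and> b i \<noteq> 0"
    and base: "twist_form 1 F G a b"
  shows "twist_form n F G a b"
  using eqs nz
proof (induction n)
  case 0
  then show ?case using base by (simp add: twist_form_def)
next
  case (Suc n)
  have nz: "\<And>i. 1 \<le> i \<Longrightarrow> i \<le> n + 2 \<Longrightarrow> a i \<noteq> 0 \<and> b i \<noteq> 0"
    using Suc.prems(2) by simp
  show ?case
  proof (cases "n = 0")
    case True
    then show ?thesis using base by simp
  next
    case False
    then have n: "1 \<le> n" by simp
    have form: "twist_form n F G a b"
      using Suc.IH nz Suc.prems(1) by (auto simp: twist_eqs_def)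
    have gaps: "under_gap a b (n + 1) = a (n + 1) * b (n + 1) * over_gap a b n"
       "under_gap a b n = a (n + 1) * b (n + 1) * over_gap a b (n + 1)"
      using twist_eqs_gaps[of "Suc n" a b] nz Suc.prems(1) n by auto
    have *: "G (int n + 1) \<noteq> 0" "G (int n + 2) \<noteq> 0"
      "a (n + 1) = F (int n + 1) / G (int n + 1)" "b (n + 1) = F (int n) / G (int n + 2)"
      using twist_formD_Suc[OF form, of n] by auto
    then have F: "F (int n + 1) \<noteq> 0" "F (int n) \<noteq> 0" using nz[of "n + 1"] by auto
    have "a n \<noteq> 0" using nz[of n] n by simp
    note g = twist_form_gaps[OF form rec n order_refl this]
    have "under_gap a b (n + 1) = s * F (int n + 1) / G (int n + 2)"
      using gaps(1) g nz[of n] n * F by simp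
    then have a: "a (n + 2) = F (int n + 2) / G (int n + 2)"
      using * fib_recD[OF rec(1), of "int n + 1"]
      by (simp add: under_gap_def field_simps)
    have "over_gap a b (n + 1) = s * G (int n + 2) / F (int n + 1)"
      using gaps(2)[unfolded g(1) *(3,4)] *(1,2) F by (simp add: field_simps)
    \<comment> \<open>The reciprocal is computed first because \<open>G (int n + 3)\<close> is not
      yet known to be nonzero; that is read off from the result.\<close>
    then have "1 / b (n + 2) = (s * G (int n + 2) + G (int n + 1)) / F (int n + 1)"
      unfolding over_gap_def *(3) by (simp add: diff_eq_eq add_divide_distrib)
    then have b: "1 / b (n + 2) = G (int n + 3) / F (int n + 1)"
      using fib_recD[OF rec(2), of "int n + 2"] by (simp add: add.commute)
    have G: "G (int n + 3) \<noteq> 0" using b nz[of "n + 2"] by auto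
    have "b (n + 2) = F (int n + 1) / G (int n + 3)"
      using b G F nz[of "n + 2"] by (simp add: field_simps)
    moreover have "{1..Suc n + 1} = insert (n + 2) {1..n + 1}" by auto
    ultimately show ?thesis using form a G *(2)
      by (simp add: twist_form_def algebra_simps)
  qed
qed

text \<open>The products \<open>a (i + 1) * b (i + 1)\<close> do not vanish, so a zero gap changes
  strand at every crossing, and the parity of \<open>i\<close> tells on which strand it
  started.\<close>

lemma twist_eqs_gap_zero_iff:
  assumes eqs: "twist_eqs n a b"
    and nz: "\<And>i. 1 \<le> i \<Longrightarrow> i \<le> n + 1 \<Longrightarrow> a i \<noteq> 0 \<and> b i \<noteq> 0"
    and "1 \<le> i" "i \<le> n"
  shows "(under_gap a b i = 0 \<longleftrightarrow> (if odd i then under_gap a b 1 = 0 else over_gap a b 1 = 0)) \<and>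
    (over_gap a b i = 0 \<longleftrightarrow> (if odd i then over_gap a b 1 = 0 else under_gap a b 1 = 0))"
  using assms(3,4)
proof (induction i rule: dec_induct)
  case base
  then show ?case by simp
next
  case (step i)
  then have "under_gap a b (i + 1) = a (i + 1) * b (i + 1) * over_gap a b i"
     "under_gap a b i = a (i + 1) * b (i + 1) * over_gap a b (i + 1)"
    using eqs twist_eqs_gaps[of n a b] nz by auto
  moreover have "a (i + 1) \<noteq> 0" "b (i + 1) \<noteq> 0" using nz[of "i + 1"] step by auto
  ultimately show ?case using step by auto
qed

text \<open>Zero gaps mean \<open>a (i + 1) = b i\<close> and \<open>b (i + 1) = a i\<close>, so
  every crossing swaps the two values.\<close>

lemma twist_gaps_zero:
  assumes eqs: "twist_eqs n a b"
    and nz: "\<And>i. 1 \<le> i \<Longrightarrow> i \<le> n + 1 \<Longrightarrow> a i \<noteq> 0 \<and> b i \<noteq> 0"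
    and zero: "under_gap a b 1 = 0" "over_gap a b 1 = 0"
    and "1 \<le> i" "i \<le> n + 1"
  shows "a i = (if odd i then a 1 else b 1) \<and> b i = (if odd i then b 1 else a 1)"
  using assms(5,6)
proof (induction i rule: dec_induct)
  case (step i)
  then have "under_gap a b i = 0" "over_gap a b i = 0"
    using twist_eqs_gap_zero_iff[OF eqs nz, of i] zero by auto
  then show ?case using step by (auto simp: under_gap_def over_gap_def)
qed simp

section \<open>Two rows glued along their ends\<close>

text \<open>Abstracts the two boxes from the diagram. In \<open>adjacent\<close>, the inequalities
  \<open>a 1 \<noteq> a (N + 1)\<close> and \<open>b 1 \<noteq> b (N + 1)\<close> come from corners
  of the second box, the others from the first.\<close>

locale double_twist =
  fixes N M :: nat and a b a' b' :: "nat \<Rightarrow> complex"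
  assumes N: "1 \<le> N" and M: "1 \<le> M"
    and nonzero: "\<And>i. 1 \<le> i \<Longrightarrow> i \<le> N + 1 \<Longrightarrow> a i \<noteq> 0 \<and> b i \<noteq> 0"
    and nonzero': "\<And>i. 1 \<le> i \<Longrightarrow> i \<le> M + 1 \<Longrightarrow> a' i \<noteq> 0 \<and> b' i \<noteq> 0"
    and joins: "a' 1 = b 1" "b' 1 = b (N + 1)" "a' (M + 1) = a 1" "b' (M + 1) = a (N + 1)"
    and adjacent: "a 1 \<noteq> b 1" "a 1 \<noteq> a 2" "b 1 \<noteq> b 2" "a 1 \<noteq> a (N + 1)" "b 1 \<noteq> b (N + 1)"
      "a N \<noteq> a (N + 1)" "b N \<noteq> b (N + 1)"
begin

text \<open>
  These are the equations of the four segments shared by both rows: subtracting 1 from both sides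
  of an equation between an over factor and an under factor turns each numerator into a multiple
  of a gap.
\<close>

definition closing_eqs :: bool where
  "closing_eqs \<longleftrightarrow>
     under_gap a b 1 * (a 1 - a (N + 1)) + a 1 * a (N + 1) * over_gap a' b' M * (a 1 - a 2) = 0 \<and>
     under_gap a' b' 1 * (b 1 - b 2) = b 1 * b 2 * over_gap a b 1 * (b 1 - b (N + 1)) \<and>
     under_gap a' b' M * (a (N + 1) - a N) = a N * a (N + 1) * over_gap a b N * (a (N + 1) - a 1) \<and>
     over_gap a' b' 1 * b 1 * b (N + 1) * (b (N + 1) - b N) + under_gap a b N * (b (N + 1) - b 1) = 0"

definition solution :: bool where
  "solution \<longleftrightarrow> twist_eqs N a b \<and> twist_eqs M a' b' \<and> closing_eqs"

text \<open>
  A vanishing gap is passed on from crossing to crossing, alternating between the strands, and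
  across the closing equations.  If one of \<open>N\<close>, \<open>M\<close> is even this forces all gaps to vanish, so that
  each row merely permutes two values, contradicting the distinctness of adjacent segments.
\<close>

lemma gaps_nonzero:
  assumes sol: "solution" and even: "even N \<or> even M"
  shows "under_gap a b 1 \<noteq> 0" "over_gap a b 1 \<noteq> 0"
proof -
  have eqs: "twist_eqs N a b" "twist_eqs M a' b'" and cl: closing_eqs
    using sol by (auto simp: solution_def)
  have nz: "a 1 \<noteq> 0" "a 2 \<noteq> 0" "b 1 \<noteq> 0" "b 2 \<noteq> 0" "a N \<noteq> 0" "a (N + 1) \<noteq> 0" "b (N + 1) \<noteq> 0"
    using nonzero[of 1] nonzero[of 2] nonzero[of N] nonzero[of "N + 1"] N by (auto simp: numeral_2_eq_2)
  \<comment> \<open>Each closing equation balances one gap from each row, with coefficients that are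
    nonzero by \<open>adjacent\<close>.\<close>
  have ends: "under_gap a b 1 = 0 \<longleftrightarrow> over_gap a' b' M = 0"
    "under_gap a' b' 1 = 0 \<longleftrightarrow> over_gap a b 1 = 0"
    "under_gap a' b' M = 0 \<longleftrightarrow> over_gap a b N = 0"
    "over_gap a' b' 1 = 0 \<longleftrightarrow> under_gap a b N = 0"
    using cl nz adjacent unfolding closing_eqs_def by auto
  have gN: "(under_gap a b N = 0 \<longleftrightarrow> (if odd N then under_gap a b 1 = 0 else over_gap a b 1 = 0)) \<and>
    (over_gap a b N = 0 \<longleftrightarrow> (if odd N then over_gap a b 1 = 0 else under_gap a b 1 = 0))"
    by (rule twist_eqs_gap_zero_iff[OF eqs(1) nonzero N order_refl])
  have gM: "(under_gap a' b' M = 0 \<longleftrightarrow> (if odd M then under_gap a' b' 1 = 0 else over_gap a' b' 1 = 0)) \<and>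
    (over_gap a' b' M = 0 \<longleftrightarrow> (if odd M then over_gap a' b' 1 = 0 else under_gap a' b' 1 = 0))"
    by (rule twist_eqs_gap_zero_iff[OF eqs(2) nonzero' M order_refl])
  have "under_gap a b 1 \<noteq> 0 \<and> over_gap a b 1 \<noteq> 0"
  proof (rule ccontr)
    assume "\<not> ?thesis"
    \<comment> \<open>Going round both rows through \<open>ends\<close>, \<open>gN\<close> and
      \<open>gM\<close> links \<open>under_gap a b 1\<close> to \<open>over_gap a b 1\<close> as
      soon as \<open>N\<close> or \<open>M\<close> is even; one zero gap then makes all of them
      zero.\<close>
    then have z: "under_gap a b 1 = 0" "over_gap a b 1 = 0" "under_gap a' b' 1 = 0" "over_gap a' b' 1 = 0"
      using ends even gN gM by (smt (verit))+
    have aN: "a (N + 1) = (if odd (N + 1) then a 1 else b 1)"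
      using twist_gaps_zero[OF eqs(1) nonzero z(1,2), of "N + 1"] by linarith
    have aM: "a' (M + 1) = (if odd (M + 1) then a' 1 else b' 1)"
      using twist_gaps_zero[OF eqs(2) nonzero' z(3,4), of "M + 1"] by linarith
    \<comment> \<open>For even \<open>N\<close> the first row would return to \<open>a 1\<close>,
      against \<open>a 1 \<noteq> a (N + 1)\<close>; for even \<open>M\<close> the second row would
      return to \<open>a' 1\<close>, forcing \<open>a 1 = b 1\<close>.\<close>
    have "odd N" using aN adjacent(4) by auto
    with even have "even M" by simp
    with aM joins adjacent(1) show False by simp
  qed
  then show "under_gap a b 1 \<noteq> 0" "over_gap a b 1 \<noteq> 0" by auto
qed

end

text \<open>
  \<open>C\<close> is the obstruction to the second row ending on the segments on which the first one
  starts: for \<open>C = 0\<close> its last numerators and denominators are a common multiple of those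
  prescribed by the first row.
\<close>

lemma closing_proportional:
  fixes e :: complex and N M :: nat
  assumes e: "e\<^sup>2 = (-1) ^ N"
    and rec: "fib_rec s F" "fib_rec s G"
    and rec': "fib_rec (e * s * fib_base s (int N)) F'" "fib_rec (e * s * fib_base s (int N)) G'"
    and init: "F' 0 = e * F (int N)" "F' 1 = F 0" "G' 1 = G 2" "G' 2 = e * G (int N + 2)"
  defines "B \<equiv> fib_base s" and "B' \<equiv> fib_base (e * s * fib_base s (int N))"
  defines "C \<equiv> B' (int M + 1) + e * B' (int M) * B (int N - 1)"
    and "c \<equiv> e * B (int N) * B' (int M)"
  shows "F' (int M + 1) = c * F 1 + F 0 * C" "G' (int M + 1) = c * G 1 + G 2 * C"
    "C = 0 \<Longrightarrow> F' (int M) = - e * c * F (int N + 1)"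
    "C = 0 \<Longrightarrow> G' (int M + 2) = - e * c * G (int N + 1)"
    "C = 0 \<Longrightarrow> c \<noteq> 0"
proof -
  define x y x' y' where xy: "x = B (int N)" "y = B (int N - 1)" "x' = B' (int M)" "y' = B' (int M - 1)"
  define s' where "s' = e * s * x"
  have s': "e * s * fib_base s (int N) = s'" by (simp add: s'_def xy B_def)
  have B1: "B (int N + 1) = s * x + y" "B' (int M + 1) = s' * x' + y'"
    unfolding xy B_def B'_def s' by (simp_all add: fib_base_rec)
  have cas: "(s * x + y) * y - x\<^sup>2 = e\<^sup>2"
    using fib_base_cassini[of s N] e B1 by (simp add: xy B_def)
  have cas': "(s' * x' + y') * y' - x'\<^sup>2 = (-1) ^ M"
    using fib_base_cassini[of s' M] B1 s' by (simp add: xy B'_def)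
  have X: "X (k + int N) = X (k + 1) * x + X k * y" if "fib_rec s X" for X k
    using fib_rec_add[OF that] by (simp add: xy B_def)
  have X': "X (k + int M) = X (k + 1) * x' + X k * y'" if "fib_rec s' X" for X k
    using fib_rec_add[OF that] by (simp add: xy B'_def s')
  note rec' = rec'[unfolded s']
  have F2: "F 2 = s * F 1 + F 0" "G 3 = s * G 2 + G 1"
    "F' 2 = s' * F' 1 + F' 0" "G' 3 = s' * G' 2 + G' 1"
    using fib_recD[OF rec(1), of 1] fib_recD[OF rec(2), of 2] fib_recD[OF rec'(1), of 1]
      fib_recD[OF rec'(2), of 2] by simp_all
  have FN: "F (int N) = F 1 * x + F 0 * y" "F (int N + 1) = F 2 * x + F 1 * y"
    "G (int N + 1) = G 2 * x + G 1 * y" "G (int N + 2) = G 3 * x + G 2 * y"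
    using X[OF rec(1), of 0] X[OF rec(1), of 1] X[OF rec(2), of 1] X[OF rec(2), of 2]
    by (simp_all add: add.commute)
  have FM: "F' (int M) = F' 1 * x' + F' 0 * y'" "F' (int M + 1) = F' 2 * x' + F' 1 * y'"
    "G' (int M + 1) = G' 2 * x' + G' 1 * y'" "G' (int M + 2) = G' 3 * x' + G' 2 * y'"
    using X'[OF rec'(1), of 0] X'[OF rec'(1), of 1] X'[OF rec'(2), of 1] X'[OF rec'(2), of 2]
    by (simp_all add: add.commute)
  have C: "C = s' * x' + y' + e * x' * y" by (simp add: C_def B1 xy)
  have c: "c = e * x * x'" by (simp add: c_def xy)
  show "F' (int M + 1) = c * F 1 + F 0 * C"
    unfolding FM F2 init FN c C by (simp add: algebra_simps)
  show "G' (int M + 1) = c * G 1 + G 2 * C"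
    unfolding FM init FN F2 c C s'_def by (simp add: algebra_simps)
  {
    assume "C = 0"
    then have y': "y' = - x' * (e * y + s')" unfolding C by (simp add: algebra_simps eq_neg_iff_add_eq_0)
    \<comment> \<open>Eliminating \<open>y'\<close> leaves a bracket that, by Cassini's identity for
      the first row, is 1 minus the fourth power of \<open>e\<close>, hence zero.\<close>
    have "F' (int M) + e * c * F (int N + 1) =
       F 0 * x' * (1 - e\<^sup>2 * ((s * x + y) * y - x\<^sup>2))"
      unfolding FM init FN F2 c y' s'_def by (simp add: algebra_simps power2_eq_square)
    also have "\<dots> = 0" unfolding cas by (simp add: e flip: power_mult_distrib)
    finally show "F' (int M) = - e * c * F (int N + 1)" by (simp add: eq_neg_iff_add_eq_0)
    have "G' (int M + 2) + e * c * G (int N + 1) =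
       G 2 * x' * (1 - e\<^sup>2 * ((s * x + y) * y - x\<^sup>2))"
      unfolding FM init FN F2(2,4) c y' s'_def by (simp add: algebra_simps power2_eq_square)
    also have "\<dots> = 0" unfolding cas by (simp add: e flip: power_mult_distrib)
    finally show "G' (int M + 2) = - e * c * G (int N + 1)" by (simp add: eq_neg_iff_add_eq_0)
    \<comment> \<open>Cassini's identity for the second row makes \<open>c\<close> a square root of
      a sign.\<close>
    have "c\<^sup>2 = (-1) ^ M"
    proof -
      have "(-1) ^ M = (s' * x' + y') * y' - x'\<^sup>2" using cas' by simp
      also have "\<dots> = x'\<^sup>2 * (e\<^sup>2 * (y * (s * x + y)) - 1)"
        unfolding y' s'_def by (simp add: algebra_simps power2_eq_square)
      also have "\<dots> = x'\<^sup>2 * (e\<^sup>2 * (e\<^sup>2 + x\<^sup>2) - 1)"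
        using cas by (simp add: algebra_simps)
      also have "\<dots> = c\<^sup>2"
        using e by (simp add: c algebra_simps power_mult_distrib)
      finally show ?thesis by simp
    qed
    then show "c \<noteq> 0" by auto
  }
qed

section \<open>The closing equations in Fibonacci form\<close>

context double_twist
begin

text \<open>The joins fix the quotients \<open>F' 1 / G' 1\<close> and \<open>F' 0 / G' 2\<close>.
  The factor \<open>e\<close> cancels in the latter; it absorbs the sign \<open>(-1) ^ N\<close>
  that the closing equations put between the two gaps, so that one base serves both
  \<open>F'\<close> and \<open>G'\<close>.\<close>

context
  fixes s e :: complex and F G F' G' :: "int \<Rightarrow> complex"
  assumes e: "e\<^sup>2 = (-1) ^ N"
    and rec: "fib_rec s F" "fib_rec s G"
    and rec': "fib_rec (e * s * fib_base s (int N)) F'" "fib_rec (e * s * fib_base s (int N)) G'"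
    and init: "F' 0 = e * F (int N)" "F' 1 = F 0" "G' 1 = G 2" "G' 2 = e * G (int N + 2)"
    and form: "twist_form N F G a b"
begin

lemma ends:
  "G 1 \<noteq> 0" "G 2 \<noteq> 0" "G 3 \<noteq> 0" "G (int N) \<noteq> 0" "G (int N + 1) \<noteq> 0" "G (int N + 2) \<noteq> 0"
  "a 1 = F 1 / G 1" "b 1 = F 0 / G 2" "a 2 = F 2 / G 2" "b 2 = F 1 / G 3"
  "a N = F (int N) / G (int N)" "b N = F (int N - 1) / G (int N + 1)"
  "a (N + 1) = F (int N + 1) / G (int N + 1)" "b (N + 1) = F (int N) / G (int N + 2)"
  using twist_formD[OF form, of 1] twist_formD_Suc[OF form, of 1] twist_formD[OF form, of N]
    twist_formD_Suc[OF form, of N] N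
  by (auto simp: numeral_2_eq_2)

lemma F_nonzero: "F 0 \<noteq> 0" "F 1 \<noteq> 0" "F (int N) \<noteq> 0" "F (int N + 1) \<noteq> 0" "e \<noteq> 0"
  using ends nonzero[of 1] nonzero[of N] nonzero[of "N + 1"] N e by auto

text \<open>Differences between opposite ends of the row come from \<open>fib_rec_cross\<close> and
  carry \<open>x\<close>; those at the last crossing come from the Casoratian and carry the sign
  \<open>e\<^sup>2\<close>. The nonzero factors \<open>X\<close> and \<open>Y\<close> cancel from
  the closing equations.\<close>

lemma end_differences:
  fixes x X Y :: complex
  defines "x \<equiv> fib_base s (int N)" and "X \<equiv> F 1 * G 2 - F 2 * G 1" and "Y \<equiv> F 0 * G 3 - F 1 * G 2"
  shows "a 1 - a (N + 1) = x * X / (G 1 * G (int N + 1))"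
    "a 1 - a 2 = X / (G 1 * G 2)"
    "b 1 - b (N + 1) = x * Y / (G 2 * G (int N + 2))"
    "b 1 - b 2 = Y / (G 2 * G 3)"
    "a (N + 1) - a N = e\<^sup>2 * X / (G (int N) * G (int N + 1))"
    "b (N + 1) - b N = e\<^sup>2 * Y / (G (int N + 1) * G (int N + 2))"
    "X \<noteq> 0" "Y \<noteq> 0"
proof -
  have "F 1 * G (int N + 1) - F (int N + 1) * G 1 = x * X"
    "F 0 * G (int N + 2) - F (int N) * G 2 = x * Y"
    using fib_rec_cross[OF rec, of 1 1 N] fib_rec_cross[OF rec, of 0 2 N]
    by (simp_all add: x_def X_def Y_def add.commute)
  then show "a 1 - a (N + 1) = x * X / (G 1 * G (int N + 1))"
    "b 1 - b (N + 1) = x * Y / (G 2 * G (int N + 2))"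
    using ends(1-6) unfolding ends(7-) by (simp_all add: diff_frac_eq mult.commute)
  show d: "a 1 - a 2 = X / (G 1 * G 2)" "b 1 - b 2 = Y / (G 2 * G 3)"
    using ends(1-6) unfolding ends(7-) by (simp_all add: diff_frac_eq X_def Y_def mult.commute)
  have "G 2 = s * G 1 + G 0" "F 1 = s * F 0 + F (-1)" "F 2 = s * F 1 + F 0" "G 3 = s * G 2 + G 1"
    using fib_recD[OF rec(1), of 0] fib_recD[OF rec(1), of 1] fib_recD[OF rec(2), of 1]
     fib_recD[OF rec(2), of 2] by simp_all
  then have "F (int N + 1) * G (int N) - F (int N) * G (int N + 1) = e\<^sup>2 * X"
    "F (int N) * G (int N + 1) - F (int N - 1) * G (int N + 2) = e\<^sup>2 * Y"
    using fib_rec_casoratian[OF rec, of 0 N 0] fib_rec_casoratian[OF rec, of "-1" N 1]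
    by (simp_all add: X_def Y_def e algebra_simps)
  then show "a (N + 1) - a N = e\<^sup>2 * X / (G (int N) * G (int N + 1))"
    "b (N + 1) - b N = e\<^sup>2 * Y / (G (int N + 1) * G (int N + 2))"
    using ends(1-6) unfolding ends(7-) by (simp_all add: diff_frac_eq mult.commute)
  show "X \<noteq> 0" "Y \<noteq> 0" using d adjacent by auto
qed

lemma end_gaps:
  "under_gap a b 1 = s * F 1 / G 2" "over_gap a b 1 = s * G 2 / F 1"
  "under_gap a b N = s * F (int N) / G (int N + 1)" "over_gap a b N = s * G (int N + 1) / F (int N)"
  using twist_form_gaps[OF form rec, of 1] twist_form_gaps[OF form rec, of N] nonzero[of 1]
    nonzero[of N] N by auto

lemma e_pow: "e\<^sup>2 * e\<^sup>2 = 1"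
  by (simp add: e flip: power_mult_distrib)

text \<open>By \<open>closing_proportional\<close> the gaps at both ends of the second row are
  expressions in the first row, and the closing equations become identities between
  fractions.\<close>

lemma solution_of_form:
  assumes form': "twist_form M F' G' a' b'"
    and C: "fib_base (e * s * fib_base s (int N)) (int M + 1) +
      e * fib_base (e * s * fib_base s (int N)) (int M) * fib_base s (int N - 1) = 0"
  shows solution
proof -
  define x X Y where "x = fib_base s (int N)" and "X = F 1 * G 2 - F 2 * G 1"
    and "Y = F 0 * G 3 - F 1 * G 2"
  note d = end_differences[folded x_def X_def Y_def]
  define c where "c = e * fib_base s (int N) * fib_base (e * s * fib_base s (int N)) (int M)"
  have far_end: "F' (int M + 1) = c * F 1" "G' (int M + 1) = c * G 1"
    "F' (int M) = - e * c * F (int N + 1)" "c \<noteq> 0"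
    using closing_proportional(1,2)[OF e rec rec' init, of M]
      closing_proportional(3,5)[OF e rec rec' init C] C by (simp_all add: c_def)
  have g': "under_gap a' b' 1 = e * s * x * F' 1 / G' 2" "over_gap a' b' 1 = e * s * x * G' 2 / F' 1"
    "under_gap a' b' M = e * s * x * F' (int M) / G' (int M + 1)"
    "over_gap a' b' M = e * s * x * G' (int M + 1) / F' (int M)"
    using twist_form_gaps[OF form' rec', of 1] twist_form_gaps[OF form' rec', of M] nonzero'[of 1]
      nonzero'[of M] M by (auto simp: x_def)
  have g: "under_gap a' b' 1 = s * x * F 0 / G (int N + 2)"
    "over_gap a' b' 1 = e\<^sup>2 * s * x * G (int N + 2) / F 0"
    "under_gap a' b' M = - e\<^sup>2 * s * x * F (int N + 1) / G 1"
    "over_gap a' b' M = - s * x * G 1 / F (int N + 1)"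
    unfolding g' far_end(1-3) init using far_end(4) F_nonzero ends(1-6)
    by (simp_all add: field_simps power2_eq_square)
  have d': "a (N + 1) - a 1 = - (x * X / (G 1 * G (int N + 1)))"
    "b (N + 1) - b 1 = - (x * Y / (G 2 * G (int N + 2)))"
    unfolding d(1,3)[symmetric] by simp_all
  have "closing_eqs"
    unfolding closing_eqs_def d d' g end_gaps
    unfolding ends(7-)
    using F_nonzero ends(1-6) d(7,8) e_pow
    by (simp add: divide_simps mult_ac power2_eq_square)
  moreover have "twist_eqs N a b" "twist_eqs M a' b'"
    using twist_eqs_of_form[OF form rec nonzero] twist_eqs_of_form[OF form' rec' nonzero'] by auto
  ultimately show ?thesis by (simp add: solution_def)
qed

text \<open>The second and fourth closing equations give the gaps at the first crossing of the
  second row, from which \<open>twist_form_of_eqs\<close> carries the form along.\<close>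

lemma form_of_solution:
  assumes sol: solution
  shows "twist_form M F' G' a' b'"
    and "fib_base (e * s * fib_base s (int N)) (int M + 1) +
      e * fib_base (e * s * fib_base s (int N)) (int M) * fib_base s (int N - 1) = 0"
proof -
  define x X Y where "x = fib_base s (int N)" and "X = F 1 * G 2 - F 2 * G 1"
    and "Y = F 0 * G 3 - F 1 * G 2"
  note d = end_differences[folded x_def X_def Y_def]
  have cl: closing_eqs and eqs: "twist_eqs M a' b'" using sol by (auto simp: solution_def)
  have "under_gap a' b' 1 * (b 1 - b 2) = b 1 * b 2 * over_gap a b 1 * (b 1 - b (N + 1))"
    using cl by (simp add: closing_eqs_def)
  then have u: "under_gap a' b' 1 = s * x * F 0 / G (int N + 2)"
    unfolding end_gaps d unfolding ends(7-)
    using F_nonzero ends(1-6) d(7,8) by (simp add: field_simps)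
  have "over_gap a' b' 1 * b 1 * b (N + 1) * (b (N + 1) - b N) = under_gap a b N * (b 1 - b (N + 1))"
    using cl by (simp add: closing_eqs_def algebra_simps)
  then have "e\<^sup>2 * over_gap a' b' 1 = s * x * G (int N + 2) / F 0"
    unfolding end_gaps d unfolding ends(7-)
    using F_nonzero ends(1-6) d(7,8) by (simp add: field_simps)
  then have "e\<^sup>2 * e\<^sup>2 * over_gap a' b' 1 = e\<^sup>2 * (s * x * G (int N + 2) / F 0)"
    by (simp only: mult.assoc)
  then have o: "over_gap a' b' 1 = e\<^sup>2 * s * x * G (int N + 2) / F 0" unfolding e_pow by (simp add: mult.assoc)
  have rec2: "F' 2 = e * s * x * F' 1 + F' 0" "G' 3 = e * s * x * G' 2 + G' 1"
    using fib_recD[OF rec'(1), of 1] fib_recD[OF rec'(2), of 2] by (simp_all add: x_def)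
  have a1: "a' 1 = F' 1 / G' 1" "b' 1 = F' 0 / G' 2"
    unfolding joins init ends(7-) using F_nonzero by auto
  have "a' 2 = under_gap a' b' 1 + b' 1" by (simp add: under_gap_def numeral_2_eq_2)
  also have "\<dots> = F' 2 / G' 2"
    unfolding a1 u rec2 init using F_nonzero ends(6) by (simp add: field_simps)
  finally have a2: "a' 2 = F' 2 / G' 2" .
  have "1 / b' 2 = over_gap a' b' 1 + 1 / a' 1" by (simp add: over_gap_def numeral_2_eq_2)
  also have "\<dots> = G' 3 / F' 1"
    unfolding a1 o rec2 init using F_nonzero ends(6) by (simp add: field_simps power2_eq_square)
  finally have "1 / b' 2 = G' 3 / F' 1" .
  moreover have "b' 2 \<noteq> 0" using nonzero'[of 2] M by simp
  moreover have "b' 2 = 1 / (1 / b' 2)" by simp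
  ultimately have b2: "G' 3 \<noteq> 0" "b' 2 = F' 1 / G' 3" by auto
  have "G' 1 \<noteq> 0" "G' 2 \<noteq> 0" unfolding init using F_nonzero ends by auto
  moreover have "{1..1 + 1} = {1, 2 :: nat}" by auto
  ultimately have "twist_form 1 F' G' a' b'"
    using a1 a2 b2 by (simp add: twist_form_def)
  then show form': "twist_form M F' G' a' b'"
    using twist_form_of_eqs[OF eqs rec' nonzero'] by simp
  define C where "C = fib_base (e * s * fib_base s (int N)) (int M + 1) +
      e * fib_base (e * s * fib_base s (int N)) (int M) * fib_base s (int N - 1)"
  define c where "c = e * fib_base s (int N) * fib_base (e * s * fib_base s (int N)) (int M)"
  note far_end = closing_proportional(1,2)[OF e rec rec' init, of M, folded C_def c_def]
  have "G' (int M + 1) \<noteq> 0" "a 1 = F' (int M + 1) / G' (int M + 1)"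
    using twist_formD_Suc[OF form', of M] joins by auto
  \<comment> \<open>The join at \<open>a 1\<close> yields the condition: \<open>C\<close> is
    multiplied by a determinant that vanishes only if \<open>a 1 = b 1\<close>.\<close>
  then have "F 1 * (c * G 1 + G 2 * C) = (c * F 1 + F 0 * C) * G 1"
    unfolding far_end ends(7-) using ends(1) by (simp add: frac_eq_eq)
  then have "C * (F 1 * G 2 - F 0 * G 1) = 0" by (simp add: algebra_simps)
  moreover have "F 1 * G 2 - F 0 * G 1 \<noteq> 0"
    using adjacent(1) ends(1,2) unfolding ends(7-) by (simp add: frac_eq_eq)
  ultimately show "fib_base (e * s * fib_base s (int N)) (int M + 1) +
      e * fib_base (e * s * fib_base s (int N)) (int M) * fib_base s (int N - 1) = 0"
    by (simp add: C_def)
qed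

end

end

section \<open>Orientation-free form of the hyperbolicity equations\<close>

text \<open>The contribution of one end of a segment, with left and right taken facing away from the
  crossing and hence independent of the direction of travel.\<close>

definition corner_factor :: "('c, 's) diagram \<Rightarrow> ('s \<Rightarrow> complex) \<Rightarrow> 'c \<Rightarrow> corner \<Rightarrow> complex" where
  "corner_factor D w X k =
     (let z = w (seg D X k); l = w (seg D X (ccw k)); r = w (seg D X (cw k))
      in if over_at D X k then (z - l) / (z - r) else l * (z - r) / (r * (z - l)))"

text \<open>In the equations (a) to (d) the factor of the arriving end occurs as it stands if both
  ends pass alike, and inverted otherwise. Either way the condition is symmetric in the two
  ends.\<close>

definition ends_match ::
  "('c, 's) diagram \<Rightarrow> ('s \<Rightarrow> complex) \<Rightarrow> 'c \<Rightarrow> corner \<Rightarrow> 'c \<Rightarrow> corner \<Rightarrow> bool" where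
  "ends_match D w X k Y l \<longleftrightarrow>
     (if over_at D X k \<longleftrightarrow> over_at D Y l then corner_factor D w X k * corner_factor D w Y l = 1
      else corner_factor D w X k = corner_factor D w Y l)"

lemma ends_match_commute: "ends_match D w X k Y l \<longleftrightarrow> ends_match D w Y l X k"
  by (auto simp: ends_match_def mult.commute)

lemma ccw_cw [simp]: "ccw (cw k) = k"
  by (cases k) auto

lemma corner_factor_nonzero:
  assumes "nonzero_variables D w" "corners_distinct D w" "X \<in> crossings D"
  shows "corner_factor D w X k \<noteq> 0"
proof -
  have "w (seg D X j) \<noteq> 0" "w (seg D X j) \<noteq> w (seg D X (ccw j))" for j
    using assms by (auto simp: nonzero_variables_def corners_distinct_def)
  from this[of k] this[of "cw k"] this[of "ccw k"] show ?thesis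
    by (simp add: corner_factor_def Let_def)
qed

lemma hyperbolicity_eq_iff_ends_match:
  assumes "nonzero_variables D w" "corners_distinct D w" "Y \<in> crossings D"
    and "seg D X k = seg D Y l"
  shows "hyperbolicity_eq D w X k Y l \<longleftrightarrow> ends_match D w X k Y l"
proof -
  have "hyperbolicity_eq D w X k Y l \<longleftrightarrow> corner_factor D w X k *
      (if over_at D X k \<longleftrightarrow> over_at D Y l then corner_factor D w Y l
       else inverse (corner_factor D w Y l)) = 1"
    by (cases "over_at D X k"; cases "over_at D Y l";
      simp only: hyperbolicity_eq_def corner_factor_def Let_def assms(4) inverse_divide
        if_True if_False simp_thms)
  then show ?thesis
    using corner_factor_nonzero[OF assms(1-3), of l]
    by (auto simp: ends_match_def field_simps)
qed

text \<open>An orientation selects one of the two orders of the ends of a segment, and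
  \<open>ends_match\<close> does not depend on which.\<close>

lemma boundary_parabolic_iff_ends_match:
  assumes "orientation D out" "nonzero_variables D w" "corners_distinct D w"
  shows "boundary_parabolic D out w \<longleftrightarrow>
    (\<forall>X\<in>crossings D. \<forall>Y\<in>crossings D. \<forall>k l.
       (X, k) \<noteq> (Y, l) \<and> seg D X k = seg D Y l \<longrightarrow> ends_match D w X k Y l)"
proof
  assume L: "boundary_parabolic D out w"
  show "\<forall>X\<in>crossings D. \<forall>Y\<in>crossings D. \<forall>k l.
       (X, k) \<noteq> (Y, l) \<and> seg D X k = seg D Y l \<longrightarrow> ends_match D w X k Y l"
  proof (intro ballI allI impI)
    fix X Y k l
    assume XY: "X \<in> crossings D" "Y \<in> crossings D" and eq: "(X, k) \<noteq> (Y, l) \<and> seg D X k = seg D Y l"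
    then have "(X, k) \<in> out \<longleftrightarrow> (Y, l) \<notin> out" using assms(1) unfolding orientation_def by blast
    then have "hyperbolicity_eq D w X k Y l \<or> hyperbolicity_eq D w Y l X k"
      using L XY eq unfolding boundary_parabolic_def by (cases "(X, k) \<in> out") auto
    then show "ends_match D w X k Y l"
      using hyperbolicity_eq_iff_ends_match[OF assms(2,3) XY(2), of X k l]
        hyperbolicity_eq_iff_ends_match[OF assms(2,3) XY(1), of Y l k]
        ends_match_commute[of D w X k Y l] eq by auto
  qed
next
  assume R: "\<forall>X\<in>crossings D. \<forall>Y\<in>crossings D. \<forall>k l.
       (X, k) \<noteq> (Y, l) \<and> seg D X k = seg D Y l \<longrightarrow> ends_match D w X k Y l"
  show "boundary_parabolic D out w"
    unfolding boundary_parabolic_def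
  proof (intro conjI ballI allI impI assms(2,3))
    fix X Y k l
    assume XY: "X \<in> crossings D" "Y \<in> crossings D"
      and eq: "seg D X k = seg D Y l \<and> (X, k) \<in> out \<and> (Y, l) \<notin> out"
    then have "(X, k) \<noteq> (Y, l)" by auto
    then have "ends_match D w X k Y l" using R XY eq by blast
    then show "hyperbolicity_eq D w X k Y l"
      using hyperbolicity_eq_iff_ends_match[OF assms(2,3) XY(2), of X k l] eq by blast
  qed
qed

section \<open>The diagram of \<open>J(N, -M)\<close>\<close>

text \<open>Lists each segment once, from a chosen end: the inner ones of either box from left to
  right, the four shared ones from the first box to the second.\<close>

definition joined :: "nat \<Rightarrow> nat \<Rightarrow> crossing \<Rightarrow> corner \<Rightarrow> crossing \<Rightarrow> corner \<Rightarrow> bool" where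
  "joined N M X k Y l \<longleftrightarrow>
     (\<exists>i\<in>{1..<N}. X = Box1 i \<and> Y = Box1 (i + 1) \<and> (k = UR \<and> l = UL \<or> k = LR \<and> l = LL)) \<or>
     (\<exists>i\<in>{1..<M}. X = Box2 i \<and> Y = Box2 (i + 1) \<and> (k = UR \<and> l = UL \<or> k = LR \<and> l = LL)) \<or>
     X = Box1 1 \<and> k = UL \<and> Y = Box2 M \<and> l = LR \<or>
     X = Box1 1 \<and> k = LL \<and> Y = Box2 1 \<and> l = LL \<or>
     X = Box1 N \<and> k = UR \<and> Y = Box2 M \<and> l = UR \<or>
     X = Box1 N \<and> k = LR \<and> Y = Box2 1 \<and> l = UL"

lemma J_diagram_simps [simp]:
  "crossings (J_diagram N M) = Box1 ` {1..N} \<union> Box2 ` {1..M}"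
  "seg (J_diagram N M) (Box1 i) k = Z (box_index i k)"
  "seg (J_diagram N M) (Box2 i) k = box2_seg N M (box_index i k)"
  "over_at (J_diagram N M) (Box1 i) k \<longleftrightarrow> k \<in> {UL, LR}"
  "over_at (J_diagram N M) (Box2 i) k \<longleftrightarrow> k \<notin> {UL, LR}"
  by (auto simp: J_diagram_def over_at_def)

lemma box_index_eq_iff:
  assumes "1 \<le> i" "1 \<le> j"
  shows "box_index i k = box_index j l \<longleftrightarrow> i = j \<and> k = l \<or>
    j = i + 1 \<and> (k = UR \<and> l = UL \<or> k = LR \<and> l = LL) \<or>
    i = j + 1 \<and> (l = UR \<and> k = UL \<or> l = LR \<and> k = LL)"
  using assms by (cases k; cases l; simp; presburger)

lemma box2_seg_eq_Z_iff:
  assumes "1 \<le> i" "i \<le> M"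
  shows "box2_seg N M (box_index i k) = Z n \<longleftrightarrow>
    i = 1 \<and> k = UL \<and> n = 2 * N + 2 \<or> i = 1 \<and> k = LL \<and> n = 2 \<or>
    i = M \<and> k = UR \<and> n = 2 * N + 1 \<or> i = M \<and> k = LR \<and> n = 1"
proof -
  have "2 * i - 1 \<noteq> 2" "2 * i - 1 \<noteq> 2 * M + 1" "2 * i - 1 \<noteq> 2 * M + 2" "2 * i + 1 \<noteq> 2 * M + 2"
    "2 * i \<noteq> 2 * M + 1" "2 * i - 1 = 1 \<longleftrightarrow> i = 1" "2 * i + 2 \<noteq> 2 * M + 1" "2 * i + 1 \<noteq> 2"
    using assms by presburger+
  then show ?thesis using assms by (cases k) (auto simp: box2_seg_def)
qed

lemma box2_seg_eq_iff:
  assumes "1 \<le> N" "1 \<le> m" "m \<le> 2 * M + 2" "1 \<le> n" "n \<le> 2 * M + 2"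
  shows "box2_seg N M m = box2_seg N M n \<longleftrightarrow> m = n"
  using assms by (auto simp: box2_seg_def)

lemma seg_eq_iff_joined:
  assumes "1 \<le> N" "1 \<le> M" and X: "X \<in> crossings (J_diagram N M)" and Y: "Y \<in> crossings (J_diagram N M)"
  shows "(X, k) \<noteq> (Y, l) \<and> seg (J_diagram N M) X k = seg (J_diagram N M) Y l \<longleftrightarrow>
    joined N M X k Y l \<or> joined N M Y l X k"
proof -
  have mixed: "Z (box_index i k) = box2_seg N M (box_index j l) \<longleftrightarrow>
      joined N M (Box1 i) k (Box2 j) l"
    if "1 \<le> i" "i \<le> N" "1 \<le> j" "j \<le> M" for i j k l
    using box2_seg_eq_Z_iff[of j M N l "box_index i k"] that
    by (cases k; cases l) (auto simp: joined_def, presburger+)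
  have box: "box_index i k \<ge> 1" "box_index i k \<le> 2 * i + 2" if "1 \<le> i" for i k
    using that by (cases k; simp)+
  consider (11) i j where "X = Box1 i" "Y = Box1 j" "i \<in> {1..N}" "j \<in> {1..N}"
    | (12) i j where "X = Box1 i" "Y = Box2 j" "i \<in> {1..N}" "j \<in> {1..M}"
    | (21) i j where "X = Box2 i" "Y = Box1 j" "i \<in> {1..M}" "j \<in> {1..N}"
    | (22) i j where "X = Box2 i" "Y = Box2 j" "i \<in> {1..M}" "j \<in> {1..M}"
    using X Y by auto
  then show ?thesis
  proof cases
    case 11
    then show ?thesis by (auto simp: box_index_eq_iff joined_def)
  next
    case 12
    moreover have "\<not> joined N M (Box2 j) l (Box1 i) k" for i j by (auto simp: joined_def)
    ultimately show ?thesis using mixed by simp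
  next
    case 21
    moreover have "\<not> joined N M (Box2 i) k (Box1 j) l" for i j by (auto simp: joined_def)
    ultimately show ?thesis using mixed[of j i l k] by (simp add: eq_commute[of "box2_seg _ _ _"])
  next
    case 22
    \<comment> \<open>\<open>box2_seg\<close> is injective on the indices in use, so renaming the
      extreme segments creates no coincidences inside the second box.\<close>
    have "seg (J_diagram N M) X k = seg (J_diagram N M) Y l \<longleftrightarrow> box_index i k = box_index j l"
      using 22 box[of i k] box[of j l] assms(1) by (simp add: box2_seg_eq_iff)
    then show ?thesis using 22 by (auto simp: box_index_eq_iff joined_def)
  qed
qed

lemma boundary_parabolic_J_iff:
  assumes "1 \<le> N" "1 \<le> M" "orientation (J_diagram N M) out"
    "nonzero_variables (J_diagram N M) w" "corners_distinct (J_diagram N M) w"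
  shows "boundary_parabolic (J_diagram N M) out w \<longleftrightarrow>
    (\<forall>X k Y l. joined N M X k Y l \<longrightarrow> ends_match (J_diagram N M) w X k Y l)"
proof -
  have crs: "X \<in> crossings (J_diagram N M) \<and> Y \<in> crossings (J_diagram N M)"
    if "joined N M X k Y l" for X k Y l
    using that assms(1,2) by (auto simp: joined_def)
  show ?thesis
    unfolding boundary_parabolic_iff_ends_match[OF assms(3-5)]
  proof (intro iffI allI ballI impI)
    fix X k Y l
    assume L: "\<forall>X\<in>crossings (J_diagram N M). \<forall>Y\<in>crossings (J_diagram N M). \<forall>k l.
      (X, k) \<noteq> (Y, l) \<and> seg (J_diagram N M) X k = seg (J_diagram N M) Y l \<longrightarrow>
      ends_match (J_diagram N M) w X k Y l" and j: "joined N M X k Y l"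
    note XY = crs[OF j, THEN conjunct1] crs[OF j, THEN conjunct2]
    have "(X, k) \<noteq> (Y, l) \<and> seg (J_diagram N M) X k = seg (J_diagram N M) Y l"
      using seg_eq_iff_joined[OF assms(1,2) XY, of k l] j by simp
    then show "ends_match (J_diagram N M) w X k Y l"
      by (rule L[rule_format, OF XY])
  next
    fix X Y k l
    assume R: "\<forall>X k Y l. joined N M X k Y l \<longrightarrow> ends_match (J_diagram N M) w X k Y l"
      and XY: "X \<in> crossings (J_diagram N M)" "Y \<in> crossings (J_diagram N M)"
      and eq: "(X, k) \<noteq> (Y, l) \<and> seg (J_diagram N M) X k = seg (J_diagram N M) Y l"
    have "joined N M X k Y l \<or> joined N M Y l X k"
      using seg_eq_iff_joined[OF assms(1,2) XY, of k l] eq by simp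
    then show "ends_match (J_diagram N M) w X k Y l"
      using R[THEN spec, THEN spec, THEN spec, THEN spec, THEN mp, of X k Y l]
        R[THEN spec, THEN spec, THEN spec, THEN spec, THEN mp, of Y l X k]
        ends_match_commute[of "J_diagram N M" w X k Y l] by blast
  qed
qed

section \<open>Parametrisation of the solutions by \<open>p\<close>, \<open>q\<close>,
  \<open>r\<close> and \<Lambda>\<close>

context double_twist
begin

text \<open>The formulas for the second box cover only \<open>2 \<le> i \<le> M\<close>. The outer
  pairs are segments of the first box; their form follows from the initial values at
  \<open>1\<close> and from \<open>closing_proportional\<close> at \<open>M + 1\<close>.\<close>

lemma twist_form_extend:
  assumes e: "e\<^sup>2 = (-1) ^ N"
    and rec: "fib_rec s F" "fib_rec s G"
    and rec': "fib_rec (e * s * fib_base s (int N)) F'" "fib_rec (e * s * fib_base s (int N)) G'"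
    and init: "F' 0 = e * F (int N)" "F' 1 = F 0" "G' 1 = G 2" "G' 2 = e * G (int N + 2)"
    and form: "twist_form N F G a b"
    and inner: "\<And>i. 2 \<le> i \<Longrightarrow> i \<le> M \<Longrightarrow> G' (int i) \<noteq> 0 \<and> G' (int i + 1) \<noteq> 0 \<and>
      a' i = F' (int i) / G' (int i) \<and> b' i = F' (int i - 1) / G' (int i + 1)"
    and C: "fib_base (e * s * fib_base s (int N)) (int M + 1) +
      e * fib_base (e * s * fib_base s (int N)) (int M) * fib_base s (int N - 1) = 0"
  shows "twist_form M F' G' a' b'"
  unfolding twist_form_def
proof
  fix i assume i: "i \<in> {1..M + 1}"
  note E = ends[OF e rec rec' init form] and nz = F_nonzero[OF e rec rec' init form]
  consider "i = 1" | "2 \<le> i" "i \<le> M" | "i = M + 1" using i by force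
  then show "G' (int i) \<noteq> 0 \<and> G' (int i + 1) \<noteq> 0 \<and>
      a' i = F' (int i) / G' (int i) \<and> b' i = F' (int i - 1) / G' (int i + 1)"
  proof cases
    case 1
    then show ?thesis using E nz joins init by simp
  next
    case 2
    then show ?thesis by (rule inner)
  next
    case 3
    define c where "c = e * fib_base s (int N) * fib_base (e * s * fib_base s (int N)) (int M)"
    have far_end: "F' (int M + 1) = c * F 1" "G' (int M + 1) = c * G 1"
      "F' (int M) = - e * c * F (int N + 1)" "G' (int M + 2) = - e * c * G (int N + 1)" "c \<noteq> 0"
      using closing_proportional(1,2)[OF e rec rec' init, of M]
        closing_proportional(3-5)[OF e rec rec' init C] C by (simp_all add: c_def)
    have i: "int i = int M + 1" "int M + 1 + 1 = int M + 2" "int M + 1 - 1 = int M" using 3 by auto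
    show ?thesis
      unfolding i far_end unfolding 3 joins using E nz far_end(5) by simp
  qed
qed

lemma solution_iff:
  assumes even: "even N \<or> even M" and sqr: "\<And>x. (sqr x)\<^sup>2 = x" and e: "e\<^sup>2 = (-1) ^ N"
  shows "solution \<longleftrightarrow>
    (\<exists>p q r \<Lambda> :: complex.
      let s = sqr \<Lambda>;
          B = fib_base s;
          B' = fib_base (e * s * B (int N));
          F = p * q * s * B (int N - 1) + p * (r - q) * B (int N);
          G = (r - q) * B (int N) + p * s * B (int N + 1)
      in
        (\<forall>i\<in>{1..N + 1}.
           (r - q) * B (int i - 2) + p * s * B (int i - 1) \<noteq> 0 \<and>
           (r - q) * B (int i - 1) + p * s * B (int i) \<noteq> 0 \<and>
           a i =
             (p * q * s * B (int i - 1) + p * (r - q) * B (int i)) /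
             ((r - q) * B (int i - 2) + p * s * B (int i - 1)) \<and>
           b i =
             (p * q * s * B (int i - 2) + p * (r - q) * B (int i - 1)) /
             ((r - q) * B (int i - 1) + p * s * B (int i))) \<and>
        (\<forall>i\<in>{2..M}.
           p * s * B' (int i - 1) + e * G * B' (int i) \<noteq> 0 \<and>
           p * s * B' (int i - 2) + e * G * B' (int i - 1) \<noteq> 0 \<and>
           b' i =
             (e * F * B' (int i - 2) + p * q * s * B' (int i - 1)) /
             (p * s * B' (int i - 1) + e * G * B' (int i)) \<and>
           a' i =
             (e * F * B' (int i - 1) + p * q * s * B' (int i)) /
             (p * s * B' (int i - 2) + e * G * B' (int i - 1))) \<and>
        B' (int M + 1) + e * B' (int M) * B (int N - 1) = 0)"
    (is "_ \<longleftrightarrow> (\<exists>p q r \<Lambda>. ?P p q r \<Lambda>)")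
proof -
  \<comment> \<open>The numerators and denominators of the claimed formulas, indexed so as to fit
    \<open>twist_form\<close> and the initial values of the second row.\<close>
  define F where "F p q r s i = p * q * s * fib_base s (i - 1) + p * (r - q) * fib_base s i"
    for p q r s i
  define G where "G p q r s i = (r - q) * fib_base s (i - 2) + p * s * fib_base s (i - 1)"
    for p q r s i
  define s' where "s' s = e * s * fib_base s (int N)" for s
  define F' where "F' p q r s i = e * F p q r s (int N) * fib_base (s' s) (i - 1) +
    p * q * s * fib_base (s' s) i" for p q r s i
  define G' where "G' p q r s i = p * s * fib_base (s' s) (i - 2) +
    e * G p q r s (int N + 2) * fib_base (s' s) (i - 1)" for p q r s i
  have rec: "fib_rec s (F p q r s)" "fib_rec s (G p q r s)" for p q r s
    using fib_rec_combination[of s "p * q * s" "-1" "p * (r - q)" 0]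
      fib_rec_combination[of s "r - q" "-2" "p * s" "-1"] by (simp_all add: F_def[abs_def] G_def[abs_def])
  have rec': "fib_rec (e * s * fib_base s (int N)) (F' p q r s)"
    "fib_rec (e * s * fib_base s (int N)) (G' p q r s)" for p q r s
    using fib_rec_combination[of "s' s" "e * F p q r s (int N)" "-1" "p * q * s" 0]
      fib_rec_combination[of "s' s" "p * s" "-2" "e * G p q r s (int N + 2)" "-1"]
    by (simp_all add: F'_def[abs_def] G'_def[abs_def] s'_def)
  have init: "F' p q r s 0 = e * F p q r s (int N)" "F' p q r s 1 = F p q r s 0"
    "G' p q r s 1 = G p q r s 2" "G' p q r s 2 = e * G p q r s (int N + 2)" for p q r s
    by (simp_all add: F_def G_def F'_def G'_def)
  have P: "?P p q r \<Lambda> \<longleftrightarrow> twist_form N (F p q r s) (G p q r s) a b \<and>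
     (\<forall>i\<in>{2..M}. G' p q r s (int i) \<noteq> 0 \<and> G' p q r s (int i + 1) \<noteq> 0 \<and>
        a' i = F' p q r s (int i) / G' p q r s (int i) \<and>
        b' i = F' p q r s (int i - 1) / G' p q r s (int i + 1)) \<and>
     fib_base (e * s * fib_base s (int N)) (int M + 1) +
      e * fib_base (e * s * fib_base s (int N)) (int M) * fib_base s (int N - 1) = 0"
    if "s = sqr \<Lambda>" for p q r s \<Lambda>
  proof -
    have shift: "i + 1 - 1 = i" "i + 1 - 2 = i - 1" "i - 1 - 1 = i - 2" "i + 2 - 2 = i"
      "i + 2 - 1 = i + 1" for i :: int by auto
    show ?thesis
      unfolding Let_def that[symmetric] twist_form_def F'_def G'_def F_def G_def s'_def shift
      by blast
  qed
  show ?thesis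
  proof
    assume sol: solution
    \<comment> \<open>The parameters are the variables z_1, z_2, z_3 and the constant product of
      gaps. The parity assumption makes \<open>s\<close> and \<open>r - q\<close> nonzero.\<close>
    define p q r \<Lambda> where "p = a 1" and "q = b 1" and "r = a 2"
      and "\<Lambda> = under_gap a b 1 * over_gap a b 1"
    define s where "s = sqr \<Lambda>"
    note gaps = gaps_nonzero[OF sol even]
    have rq: "r - q = under_gap a b 1" by (simp add: under_gap_def r_def q_def numeral_2_eq_2)
    have s2: "s * s = \<Lambda>" using sqr[of \<Lambda>] by (simp add: s_def power2_eq_square)
    have nz: "s \<noteq> 0" "r - q \<noteq> 0" "p \<noteq> 0" "b 2 \<noteq> 0"
      using s2 gaps nonzero[of 1] nonzero[of 2] N by (auto simp: \<Lambda>_def p_def rq)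
    \<comment> \<open>As \<open>s * s\<close> is the product of the gaps, the third denominator
      \<open>r - q + p * s * s\<close> can be expressed by \<open>b 2\<close>.\<close>
    have "over_gap a b 1 = 1 / b 2 - 1 / p" by (simp add: over_gap_def p_def numeral_2_eq_2)
    then have "1 + p * over_gap a b 1 = p / b 2"
      using nz by (simp add: field_simps)
    moreover have "(r - q) + p * s * s = (r - q) * (1 + p * over_gap a b 1)"
      by (simp only: mult.assoc s2 \<Lambda>_def rq) (simp add: algebra_simps)
    ultimately have "(r - q) + p * s * s = p * (r - q) / b 2"
      by (simp add: mult.commute)
    moreover have "fib_base s 2 = s" using fib_base_rec[of s 1] by simp
    ultimately have v: "F p q r s 0 = p * q * s" "F p q r s 1 = p * (r - q)" "F p q r s 2 = p * r * s"
      "G p q r s 1 = r - q" "G p q r s 2 = p * s" "G p q r s 3 = p * (r - q) / b 2"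
      by (simp_all add: F_def G_def algebra_simps)
    have "{1..1 + 1} = {1, 2 :: nat}" by auto
    then have "twist_form 1 (F p q r s) (G p q r s) a b"
      using nz by (simp add: twist_form_def v) (simp add: p_def q_def r_def)
    then have form: "twist_form N (F p q r s) (G p q r s) a b"
      using twist_form_of_eqs[OF _ rec nonzero] sol by (simp add: solution_def)
    note form_of_solution[OF e rec rec' init form sol]
    then have "?P p q r \<Lambda>"
      unfolding P[OF s_def] using form by (simp add: twist_form_def)
    then show "\<exists>p q r \<Lambda>. ?P p q r \<Lambda>" by blast
  next
    assume "\<exists>p q r \<Lambda>. ?P p q r \<Lambda>"
    then obtain p q r \<Lambda> where R: "?P p q r \<Lambda>" by blast
    define s where "s = sqr \<Lambda>"
    note R' = R[unfolded P[OF s_def]]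
    have C: "fib_base (e * s * fib_base s (int N)) (int M + 1) +
      e * fib_base (e * s * fib_base s (int N)) (int M) * fib_base s (int N - 1) = 0"
      and form: "twist_form N (F p q r s) (G p q r s) a b" using R' by blast+
    have "twist_form M (F' p q r s) (G' p q r s) a' b'"
      by (rule twist_form_extend[OF e rec rec' init form _ C]) (use R' in auto)
    then show solution by (rule solution_of_form[OF e rec rec' init form _ C])
  qed
qed

end

section \<open>From segment variables to two glued rows\<close>

text \<open>
  In the second box the roles of the upper and the lower segments are exchanged: reflection in a
  horizontal line also swaps over and under, so both boxes satisfy the same recursion.
\<close>

definition box1_a :: "(segment \<Rightarrow> complex) \<Rightarrow> nat \<Rightarrow> complex" where
  "box1_a w i = w (Z (2 * i - 1))"

definition box1_b :: "(segment \<Rightarrow> complex) \<Rightarrow> nat \<Rightarrow> complex" where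
  "box1_b w i = w (Z (2 * i))"

definition box2_a :: "nat \<Rightarrow> nat \<Rightarrow> (segment \<Rightarrow> complex) \<Rightarrow> nat \<Rightarrow> complex" where
  "box2_a N M w i = w (box2_seg N M (2 * i))"

definition box2_b :: "nat \<Rightarrow> nat \<Rightarrow> (segment \<Rightarrow> complex) \<Rightarrow> nat \<Rightarrow> complex" where
  "box2_b N M w i = w (box2_seg N M (2 * i - 1))"

lemma corner_variables:
  "w (Z (box_index i UL)) = box1_a w i" "w (Z (box_index i LL)) = box1_b w i"
  "w (Z (box_index i UR)) = box1_a w (i + 1)" "w (Z (box_index i LR)) = box1_b w (i + 1)"
  "w (box2_seg N M (box_index i UL)) = box2_b N M w i"
  "w (box2_seg N M (box_index i LL)) = box2_a N M w i"
  "w (box2_seg N M (box_index i UR)) = box2_b N M w (i + 1)"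
  "w (box2_seg N M (box_index i LR)) = box2_a N M w (i + 1)"
  by (simp_all add: box1_a_def box1_b_def box2_a_def box2_b_def)

lemma box1_distinct:
  assumes "corners_distinct (J_diagram N M) w" "1 \<le> i" "i \<le> N"
  shows "box1_a w i \<noteq> box1_b w i" "box1_b w i \<noteq> box1_b w (i + 1)"
    "box1_b w (i + 1) \<noteq> box1_a w (i + 1)" "box1_a w (i + 1) \<noteq> box1_a w i"
proof -
  have "w (Z (box_index i k)) \<noteq> w (Z (box_index i (ccw k)))" for k
    using assms unfolding corners_distinct_def by (auto dest!: bspec[of _ _ "Box1 i"])
  from this[of UL] this[of LL] this[of LR] this[of UR]
  show "box1_a w i \<noteq> box1_b w i" "box1_b w i \<noteq> box1_b w (i + 1)"
    "box1_b w (i + 1) \<noteq> box1_a w (i + 1)" "box1_a w (i + 1) \<noteq> box1_a w i"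
    unfolding ccw.simps corner_variables .
qed

lemma box2_distinct:
  assumes "corners_distinct (J_diagram N M) w" "1 \<le> i" "i \<le> M"
  shows "box2_b N M w i \<noteq> box2_a N M w i" "box2_a N M w i \<noteq> box2_a N M w (i + 1)"
    "box2_a N M w (i + 1) \<noteq> box2_b N M w (i + 1)" "box2_b N M w (i + 1) \<noteq> box2_b N M w i"
proof -
  have "w (box2_seg N M (box_index i k)) \<noteq> w (box2_seg N M (box_index i (ccw k)))" for k
    using assms unfolding corners_distinct_def by (auto dest!: bspec[of _ _ "Box2 i"])
  from this[of UL] this[of LL] this[of LR] this[of UR]
  show "box2_b N M w i \<noteq> box2_a N M w i" "box2_a N M w i \<noteq> box2_a N M w (i + 1)"
    "box2_a N M w (i + 1) \<noteq> box2_b N M w (i + 1)" "box2_b N M w (i + 1) \<noteq> box2_b N M w i"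
    unfolding ccw.simps corner_variables .
qed

lemma variables_nonzero:
  assumes nz: "nonzero_variables (J_diagram N M) w" and "1 \<le> N" "1 \<le> M" "1 \<le> i"
  shows "i \<le> N + 1 \<Longrightarrow> box1_a w i \<noteq> 0 \<and> box1_b w i \<noteq> 0"
    and "i \<le> M + 1 \<Longrightarrow> box2_a N M w i \<noteq> 0 \<and> box2_b N M w i \<noteq> 0"
proof -
  have 1: "w (Z (box_index j k)) \<noteq> 0" if "1 \<le> j" "j \<le> N" for j k
    using nz that unfolding nonzero_variables_def by (auto dest!: bspec[of _ _ "Box1 j"])
  have 2: "w (box2_seg N M (box_index j k)) \<noteq> 0" if "1 \<le> j" "j \<le> M" for j k
    using nz that unfolding nonzero_variables_def by (auto dest!: bspec[of _ _ "Box2 j"])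
  show "box1_a w i \<noteq> 0 \<and> box1_b w i \<noteq> 0" if "i \<le> N + 1"
    using that assms(2,4) 1[of i UL] 1[of i LL] 1[of N UR] 1[of N LR]
    unfolding corner_variables by (cases "i = N + 1") auto
  show "box2_a N M w i \<noteq> 0 \<and> box2_b N M w i \<noteq> 0" if "i \<le> M + 1"
    using that assms(3,4) 2[of i UL] 2[of i LL] 2[of M UR] 2[of M LR]
    unfolding corner_variables by (cases "i = M + 1") auto
qed

lemma box2_joins:
  assumes "1 \<le> N" "1 \<le> M"
  shows "box2_a N M w 1 = box1_b w 1" "box2_b N M w 1 = box1_b w (N + 1)"
    "box2_a N M w (M + 1) = box1_a w 1" "box2_b N M w (M + 1) = box1_a w (N + 1)"
  using assms by (auto simp: box1_a_def box1_b_def box2_a_def box2_b_def box2_seg_def)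

lemma double_twist_J:
  assumes "1 \<le> N" "1 \<le> M" "nonzero_variables (J_diagram N M) w" "corners_distinct (J_diagram N M) w"
  shows "double_twist N M (box1_a w) (box1_b w) (box2_a N M w) (box2_b N M w)"
proof
  note j = box2_joins[OF assms(1,2), of w]
  note d1 = box1_distinct[OF assms(4) order_refl assms(1)]
    and d2 = box1_distinct[OF assms(4,1) order_refl]
    and d3 = box2_distinct[OF assms(4) order_refl assms(2), unfolded j]
    and d4 = box2_distinct[OF assms(4,2) order_refl, unfolded j]
  show "box1_a w 1 \<noteq> box1_b w 1" "box1_a w 1 \<noteq> box1_a w 2" "box1_b w 1 \<noteq> box1_b w 2"
    "box1_a w 1 \<noteq> box1_a w (N + 1)" "box1_b w 1 \<noteq> box1_b w (N + 1)"
    "box1_a w N \<noteq> box1_a w (N + 1)" "box1_b w N \<noteq> box1_b w (N + 1)"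
    using d1 d2 d3(1) d4(3) by (auto simp: numeral_2_eq_2)
qed (use assms variables_nonzero[OF assms(3,1,2)] box2_joins[OF assms(1,2)] in auto)

lemma corner_factor_J:
  "corner_factor (J_diagram N M) w (Box1 i) UL =
    (box1_a w i - box1_b w i) / (box1_a w i - box1_a w (i + 1))"
  "corner_factor (J_diagram N M) w (Box1 i) LL =
    box1_b w (i + 1) * (box1_b w i - box1_a w i) / (box1_a w i * (box1_b w i - box1_b w (i + 1)))"
  "corner_factor (J_diagram N M) w (Box1 i) LR =
    (box1_b w (i + 1) - box1_a w (i + 1)) / (box1_b w (i + 1) - box1_b w i)"
  "corner_factor (J_diagram N M) w (Box1 i) UR =
    box1_a w i * (box1_a w (i + 1) - box1_b w (i + 1)) /
    (box1_b w (i + 1) * (box1_a w (i + 1) - box1_a w i))"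
  "corner_factor (J_diagram N M) w (Box2 i) UL =
    box2_a N M w i * (box2_b N M w i - box2_b N M w (i + 1)) /
    (box2_b N M w (i + 1) * (box2_b N M w i - box2_a N M w i))"
  "corner_factor (J_diagram N M) w (Box2 i) LL =
    (box2_a N M w i - box2_a N M w (i + 1)) / (box2_a N M w i - box2_b N M w i)"
  "corner_factor (J_diagram N M) w (Box2 i) LR =
    box2_b N M w (i + 1) * (box2_a N M w (i + 1) - box2_a N M w i) /
    (box2_a N M w i * (box2_a N M w (i + 1) - box2_b N M w (i + 1)))"
  "corner_factor (J_diagram N M) w (Box2 i) UR =
    (box2_b N M w (i + 1) - box2_b N M w i) / (box2_b N M w (i + 1) - box2_a N M w (i + 1))"
  unfolding corner_factor_def Let_def J_diagram_simps ccw.simps cw.simps corner_variables by simp_all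

lemma all_joined_iff:
  "(\<forall>X k Y l. joined N M X k Y l \<longrightarrow> P X k Y l) \<longleftrightarrow>
    (\<forall>i\<in>{1..<N}. P (Box1 i) UR (Box1 (i + 1)) UL \<and> P (Box1 i) LR (Box1 (i + 1)) LL) \<and>
    (\<forall>i\<in>{1..<M}. P (Box2 i) LR (Box2 (i + 1)) LL \<and> P (Box2 i) UR (Box2 (i + 1)) UL) \<and>
    P (Box1 1) UL (Box2 M) LR \<and> P (Box1 1) LL (Box2 1) LL \<and>
    P (Box1 N) UR (Box2 M) UR \<and> P (Box1 N) LR (Box2 1) UL" (is "?L \<longleftrightarrow> ?R")
proof
  assume L: ?L
  show ?R
    by (intro conjI ballI; rule L[rule_format]; auto simp: joined_def)
next
  assume R: ?R
  show ?L
    unfolding joined_def using R by (intro allI impI) (elim disjE bexE conjE; simp)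
qed

text \<open>For a segment \<open>z\<close> inside a box, \<open>m\<close> is its corner neighbour at
  both crossings, so \<open>z - m\<close> cancels. The variants cover both strands in both
  boxes.\<close>

lemma factors_eq_iff:
  fixes z m :: complex
  assumes "z \<noteq> m" "m \<noteq> 0" "c \<noteq> 0" "z \<noteq> c" "z \<noteq> d"
  shows "c * (z - m) / (m * (z - c)) = (z - m) / (z - d) \<longleftrightarrow> c * (z - d) = m * (z - c)"
    and "m * (z - c) / (c * (z - m)) = (z - d) / (z - m) \<longleftrightarrow> c * (z - d) = m * (z - c)"
    and "(z - m) / (z - d) = c * (z - m) / (m * (z - c)) \<longleftrightarrow> m * (z - c) = c * (z - d)"
    and "(z - d) / (z - m) = m * (z - c) / (c * (z - m)) \<longleftrightarrow> m * (z - c) = c * (z - d)"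
proof -
  have "c * (z - m) / (m * (z - c)) = (z - m) / (z - d) \<longleftrightarrow>
    (c * (z - d)) * (z - m) = (m * (z - c)) * (z - m)"
    using assms by (simp add: frac_eq_eq mult_ac)
  then show *: "c * (z - m) / (m * (z - c)) = (z - m) / (z - d) \<longleftrightarrow> c * (z - d) = m * (z - c)"
    using assms by simp
  have "m * (z - c) / (c * (z - m)) = (z - d) / (z - m) \<longleftrightarrow>
    (m * (z - c)) * (z - m) = (c * (z - d)) * (z - m)"
    using assms by (simp add: frac_eq_eq mult_ac)
  then show **: "m * (z - c) / (c * (z - m)) = (z - d) / (z - m) \<longleftrightarrow> c * (z - d) = m * (z - c)"
    using assms by auto
  show "(z - m) / (z - d) = c * (z - m) / (m * (z - c)) \<longleftrightarrow> m * (z - c) = c * (z - d)"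
    "(z - d) / (z - m) = m * (z - c) / (c * (z - m)) \<longleftrightarrow> m * (z - c) = c * (z - d)"
    using * ** by metis+
qed

lemma boundary_parabolic_J_iff_solution:
  assumes "1 \<le> N" "1 \<le> M" "orientation (J_diagram N M) out"
    and nz: "nonzero_variables (J_diagram N M) w" and dist: "corners_distinct (J_diagram N M) w"
  shows "boundary_parabolic (J_diagram N M) out w \<longleftrightarrow>
    double_twist.solution N M (box1_a w) (box1_b w) (box2_a N M w) (box2_b N M w)"
proof -
  define a b a' b' where ab: "a = box1_a w" "b = box1_b w" "a' = box2_a N M w" "b' = box2_b N M w"
  interpret double_twist N M a b a' b'
    unfolding ab by (rule double_twist_J) fact+
  note cf = corner_factor_J[of N M w, folded ab]
  have over: "over_at (J_diagram N M) (Box1 i) UL" "over_at (J_diagram N M) (Box1 i) LR"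
    "\<not> over_at (J_diagram N M) (Box1 i) LL" "\<not> over_at (J_diagram N M) (Box1 i) UR"
    "over_at (J_diagram N M) (Box2 i) LL" "over_at (J_diagram N M) (Box2 i) UR"
    "\<not> over_at (J_diagram N M) (Box2 i) UL" "\<not> over_at (J_diagram N M) (Box2 i) LR" for i
    by auto
  note d1 = box1_distinct[OF dist, folded ab] and d2 = box2_distinct[OF dist, folded ab]
  let ?P = "ends_match (J_diagram N M) w"
  have box1: "(\<forall>i\<in>{1..<N}. ?P (Box1 i) UR (Box1 (i + 1)) UL \<and> ?P (Box1 i) LR (Box1 (i + 1)) LL)
    \<longleftrightarrow> twist_eqs N a b"
    unfolding twist_eqs_def
  proof (intro ball_cong refl conj_cong)
    fix i assume i: "i \<in> {1..<N}"
    have i2: "i + 1 + 1 = i + 2" by simp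
    have D: "a (i + 1) \<noteq> b (i + 1)" "b (i + 1) \<noteq> 0" "a i \<noteq> 0" "a (i + 1) \<noteq> a i"
      "a (i + 1) \<noteq> a (i + 2)" "a (i + 1) \<noteq> 0" "b (i + 2) \<noteq> 0" "b (i + 1) \<noteq> b (i + 2)" "b (i + 1) \<noteq> b i"
      using d1[of i] d1[of "i + 1"] nonzero[of i] nonzero[of "i + 1"] nonzero[of "i + 2"] i by auto
    show "?P (Box1 i) UR (Box1 (i + 1)) UL \<longleftrightarrow>
      a i * (a (i + 1) - a (i + 2)) = b (i + 1) * (a (i + 1) - a i)"
      unfolding ends_match_def cf i2 using over D factors_eq_iff(1)[of "a (i + 1)" "b (i + 1)" "a i" "a (i + 2)"]
      by simp
    show "?P (Box1 i) LR (Box1 (i + 1)) LL \<longleftrightarrow>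
      a (i + 1) * (b (i + 1) - b (i + 2)) = b (i + 2) * (b (i + 1) - b i)"
      unfolding ends_match_def cf i2
      using over D factors_eq_iff(3)[of "b (i + 1)" "a (i + 1)" "b (i + 2)" "b i"]
      by simp
  qed
  have box2: "(\<forall>i\<in>{1..<M}. ?P (Box2 i) LR (Box2 (i + 1)) LL \<and> ?P (Box2 i) UR (Box2 (i + 1)) UL)
    \<longleftrightarrow> twist_eqs M a' b'"
    unfolding twist_eqs_def
  proof (intro ball_cong refl conj_cong)
    fix i assume i: "i \<in> {1..<M}"
    have i2: "i + 1 + 1 = i + 2" by simp
    have D: "a' (i + 1) \<noteq> b' (i + 1)" "b' (i + 1) \<noteq> 0" "a' i \<noteq> 0" "a' (i + 1) \<noteq> a' i"
      "a' (i + 1) \<noteq> a' (i + 2)" "a' (i + 1) \<noteq> 0" "b' (i + 2) \<noteq> 0" "b' (i + 1) \<noteq> b' (i + 2)" "b' (i + 1) \<noteq> b' i"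
      using d2[of i] d2[of "i + 1"] nonzero'[of i] nonzero'[of "i + 1"] nonzero'[of "i + 2"] i by auto
    show "?P (Box2 i) LR (Box2 (i + 1)) LL \<longleftrightarrow>
      a' i * (a' (i + 1) - a' (i + 2)) = b' (i + 1) * (a' (i + 1) - a' i)"
      unfolding ends_match_def cf i2 using over D factors_eq_iff(2)[of "a' (i + 1)" "b' (i + 1)" "a' i" "a' (i + 2)"]
      by simp
    show "?P (Box2 i) UR (Box2 (i + 1)) UL \<longleftrightarrow>
      a' (i + 1) * (b' (i + 1) - b' (i + 2)) = b' (i + 2) * (b' (i + 1) - b' i)"
      unfolding ends_match_def cf i2
      using over D factors_eq_iff(4)[of "b' (i + 1)" "a' (i + 1)" "b' (i + 2)" "b' i"]
      by simp
  qed
  have two: "1 + 1 = (2 :: nat)" by simp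
  have D: "a 1 \<noteq> a 2" "a 1 \<noteq> a (N + 1)" "b 1 \<noteq> b 2" "b 1 \<noteq> b (N + 1)" "a (N + 1) \<noteq> a N" "b (N + 1) \<noteq> b N"
    "a 1 \<noteq> 0" "b 1 \<noteq> 0" "a N \<noteq> 0" "a (N + 1) \<noteq> 0" "b (N + 1) \<noteq> 0" "b 2 \<noteq> 0"
    "a' M \<noteq> 0" "b' 2 \<noteq> 0"
    using adjacent nonzero[of 1] nonzero[of 2] nonzero[of N] nonzero[of "N + 1"] nonzero'[of M]
      nonzero'[of 2] N M by auto
  \<comment> \<open>For each shared segment the cross-multiplied equation is a closing equation
    times one nonzero variable: \<open>a' M\<close>, \<open>a 1\<close>, \<open>b (N + 1)\<close>
    and \<open>b' 2\<close> in turn.\<close>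
  have e1: "?P (Box1 1) UL (Box2 M) LR \<longleftrightarrow>
      under_gap a b 1 * (a 1 - a (N + 1)) + a 1 * a (N + 1) * over_gap a' b' M * (a 1 - a 2) = 0"
  proof -
    have "?P (Box1 1) UL (Box2 M) LR \<longleftrightarrow> (a 1 - b 1) * (a' M * (a 1 - a (N + 1))) =
      a (N + 1) * (a 1 - a' M) * (a 1 - a 2)"
      unfolding ends_match_def cf two joins using over D by (simp add: frac_eq_eq)
    also have "\<dots> \<longleftrightarrow> (a 2 - b 1) * (a 1 - a (N + 1)) * a' M + a 1 * (a' M - a (N + 1)) * (a 1 - a 2) = 0"
      unfolding right_minus_eq[symmetric, of "(a 1 - b 1) * (a' M * (a 1 - a (N + 1)))"]
      by (simp add: algebra_simps)
    also have "(a 2 - b 1) * (a 1 - a (N + 1)) * a' M + a 1 * (a' M - a (N + 1)) * (a 1 - a 2) = a' M *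
      (under_gap a b 1 * (a 1 - a (N + 1)) + a 1 * a (N + 1) * over_gap a' b' M * (a 1 - a 2))"
      unfolding under_gap_def over_gap_def joins two using D by (simp add: field_simps)
    finally show ?thesis using D by simp
  qed
  have e2: "?P (Box1 1) LL (Box2 1) LL \<longleftrightarrow>
      under_gap a' b' 1 * (b 1 - b 2) = b 1 * b 2 * over_gap a b 1 * (b 1 - b (N + 1))"
  proof -
    have "?P (Box1 1) LL (Box2 1) LL \<longleftrightarrow> b 2 * (b 1 - a 1) * (b 1 - b (N + 1)) =
      (b 1 - a' 2) * (a 1 * (b 1 - b 2))"
      unfolding ends_match_def cf two joins using over D by (simp add: frac_eq_eq)
    also have "\<dots> \<longleftrightarrow> a 1 * ((a' 2 - b (N + 1)) * (b 1 - b 2)) = b 1 * (a 1 - b 2) * (b 1 - b (N + 1))"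
      by (auto simp: algebra_simps)
    also have "b 1 * (a 1 - b 2) * (b 1 - b (N + 1)) =
      a 1 * (b 1 * b 2 * over_gap a b 1 * (b 1 - b (N + 1)))"
      unfolding over_gap_def joins two using D by (simp add: field_simps)
    finally show ?thesis using D by (simp add: under_gap_def joins[unfolded One_nat_def] numeral_2_eq_2)
  qed
  have e3: "?P (Box1 N) UR (Box2 M) UR \<longleftrightarrow>
      under_gap a' b' M * (a (N + 1) - a N) = a N * a (N + 1) * over_gap a b N * (a (N + 1) - a 1)"
  proof -
    have "?P (Box1 N) UR (Box2 M) UR \<longleftrightarrow> a N * (a (N + 1) - b (N + 1)) * (a (N + 1) - a 1) =
      (a (N + 1) - b' M) * (b (N + 1) * (a (N + 1) - a N))"
      unfolding ends_match_def cf joins using over D by (simp add: frac_eq_eq)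
    also have "\<dots> \<longleftrightarrow> b (N + 1) * ((a 1 - b' M) * (a (N + 1) - a N)) =
      a (N + 1) * (a N - b (N + 1)) * (a (N + 1) - a 1)"
      by (auto simp: algebra_simps)
    also have "a (N + 1) * (a N - b (N + 1)) * (a (N + 1) - a 1) =
      b (N + 1) * (a N * a (N + 1) * over_gap a b N * (a (N + 1) - a 1))"
      unfolding over_gap_def using D by (simp add: field_simps)
    finally show ?thesis unfolding under_gap_def joins using D by simp
  qed
  have e4: "?P (Box1 N) LR (Box2 1) UL \<longleftrightarrow>
     over_gap a' b' 1 * b 1 * b (N + 1) * (b (N + 1) - b N) + under_gap a b N * (b (N + 1) - b 1) = 0"
  proof -
    have "?P (Box1 N) LR (Box2 1) UL \<longleftrightarrow> (b (N + 1) - a (N + 1)) * (b' 2 * (b (N + 1) - b 1)) =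
      b 1 * (b (N + 1) - b' 2) * (b (N + 1) - b N)"
      unfolding ends_match_def cf two joins using over D by (simp add: frac_eq_eq)
    also have "\<dots> \<longleftrightarrow> b (N + 1) * (b 1 - b' 2) * (b (N + 1) - b N) +
      b' 2 * ((a (N + 1) - b N) * (b (N + 1) - b 1)) = 0"
      unfolding right_minus_eq[symmetric, of "(b (N + 1) - a (N + 1)) * (b' 2 * (b (N + 1) - b 1))"]
      by (auto simp: algebra_simps)
    also have "b (N + 1) * (b 1 - b' 2) * (b (N + 1) - b N) +
      b' 2 * ((a (N + 1) - b N) * (b (N + 1) - b 1)) = b' 2 *
     (over_gap a' b' 1 * b 1 * b (N + 1) * (b (N + 1) - b N) + under_gap a b N * (b (N + 1) - b 1))"
      unfolding under_gap_def over_gap_def joins two using D by (simp add: field_simps)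
    finally show ?thesis using D by simp
  qed
  show ?thesis
    unfolding boundary_parabolic_J_iff[OF assms] all_joined_iff box1 box2 e1 e2 e3 e4
      solution_def[unfolded closing_eqs_def] ab[symmetric] by blast
qed

theorem theorem6p8:
  fixes N M :: nat
    and out :: "(crossing \<times> corner) set"
    and w :: "segment \<Rightarrow> complex"
    and sqr :: "complex \<Rightarrow> complex"
    and \<iota> :: complex
  assumes "N \<ge> 1" and "M \<ge> 1" and "even N \<or> even M"
    and "orientation (J_diagram N M) out"
    and "nonzero_variables (J_diagram N M) w"
    and "corners_distinct (J_diagram N M) w"
    and sqr: "\<And>x. (sqr x)\<^sup>2 = x"
    and iota: "\<iota>\<^sup>2 = -1"
  shows "boundary_parabolic (J_diagram N M) out w \<longleftrightarrow>
    (\<exists>p q r \<Lambda> :: complex.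
      let s = sqr \<Lambda>;
          B = fib_base s;
          B' = fib_base (\<iota> ^ N * s * B (int N));
          F = p * q * s * B (int N - 1) + p * (r - q) * B (int N);
          G = (r - q) * B (int N) + p * s * B (int N + 1)
      in
        (\<forall>i\<in>{1..N + 1}.
           (r - q) * B (int i - 2) + p * s * B (int i - 1) \<noteq> 0 \<and>
           (r - q) * B (int i - 1) + p * s * B (int i) \<noteq> 0 \<and>
           w (Z (2 * i - 1)) =
             (p * q * s * B (int i - 1) + p * (r - q) * B (int i)) /
             ((r - q) * B (int i - 2) + p * s * B (int i - 1)) \<and>
           w (Z (2 * i)) =
             (p * q * s * B (int i - 2) + p * (r - q) * B (int i - 1)) /
             ((r - q) * B (int i - 1) + p * s * B (int i))) \<and>
        (\<forall>i\<in>{2..M}.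
           p * s * B' (int i - 1) + \<iota> ^ N * G * B' (int i) \<noteq> 0 \<and>
           p * s * B' (int i - 2) + \<iota> ^ N * G * B' (int i - 1) \<noteq> 0 \<and>
           w (Z' (2 * i - 1)) =
             (\<iota> ^ N * F * B' (int i - 2) + p * q * s * B' (int i - 1)) /
             (p * s * B' (int i - 1) + \<iota> ^ N * G * B' (int i)) \<and>
           w (Z' (2 * i)) =
             (\<iota> ^ N * F * B' (int i - 1) + p * q * s * B' (int i)) /
             (p * s * B' (int i - 2) + \<iota> ^ N * G * B' (int i - 1))) \<and>
        B' (int M + 1) + \<iota> ^ N * B' (int M) * B (int N - 1) = 0)"

proof -
  let ?a = "box1_a w" and ?b = "box1_b w" and ?a' = "box2_a N M w" and ?b' = "box2_b N M w"
  interpret double_twist N M ?a ?b ?a' ?b'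
    by (rule double_twist_J) fact+
  \<comment> \<open>The number (-1)^(N/2) enters \<open>solution_iff\<close> through its
    square.\<close>
  have e: "(\<iota> ^ N)\<^sup>2 = (-1) ^ N"
    using iota by (metis power_mult mult.commute)
  have vars: "w (Z (2 * i - 1)) = ?a i" "w (Z (2 * i)) = ?b i" for i
    by (simp_all add: box1_a_def box1_b_def)
  \<comment> \<open>In this range neither index is one of the four extreme ones, so
    \<open>box2_seg\<close> does not rename the segment.\<close>
  have vars': "w (Z' (2 * i)) = ?a' i" "w (Z' (2 * i - 1)) = ?b' i" if "i \<in> {2..M}" for i
  proof -
    have "2 * i - 1 \<notin> {1, 2, 2 * M + 1, 2 * M + 2}" "2 * i \<notin> {1, 2, 2 * M + 1, 2 * M + 2}"
      using that by auto
    then show "w (Z' (2 * i)) = ?a' i" "w (Z' (2 * i - 1)) = ?b' i"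
      by (auto simp: box2_a_def box2_b_def box2_seg_def)
  qed
  show ?thesis
    unfolding boundary_parabolic_J_iff_solution[OF assms(1,2,4-6)]
      solution_iff[OF assms(3) sqr e] Let_def vars
    by (simp only: vars' cong: ball_cong)
qed

end
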